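(* In a typical RAM model, the problem with $2\times 2$ window and upper constraints is solvable in $O(mn(m+n)(1+U_{\min}))$ time, where $U_{\min}=\min_{i,j}U_{ij}$. That is, there is an algorithm which, given integers $m,n\ge 2$, an integer matrix $S\in M_{m-1,n-1}$ and a matrix $U\in M_{mn}$ with nonnegative integer entries, runs in time $O(mn(m+n)(1+U_{\min}))$ and either outputs a matrix $A\in M_{mn}$ such that $0\le A\le U$ and $\Sigma_{22}(A)=S$, or correctly reports that no such matrix exists.
   Context: For positive integers $m,n$, $M_{mn}$ (also written $M_{m,n}$) is the set of all integer matrices with $m$ rows and $n$ columns; rows are numbered $0,\dots,m-1$ and columns $0,\dots,n-1$. For $1\le m'\le m$ and $1\le n'\le n$, the map $\Sigma_{m'n'}:M_{mn}\to M_{m-m'+1,\,n-n'+1}$ sends $A$ to the matrix of sums over all contiguous $m'\times n'$ windows: $(\Sigma_{m'n'}(A))_{ij}=\sum_{a=0}^{m'-1}\sum_{b=0}^{n'-1}A_{i+a,\,j+b}$. In particular $\Sigma_{22}(A)_{ij}=A_{ij}+A_{i+1,j}+A_{i,j+1}+A_{i+1,j+1}$. The notation $0\le A\le U$ means $0\le A_{ij}\le U_{ij}$ for all $i,j$. The problem with $m'\times n'$ window and upper constraints is: given $S\in M_{m-m'+1,n-n'+1}$ and an upper constraints matrix $U\in M_{mn}$, find a matrix $A\in M_{mn}$ with $0\le A\le U$ and $\Sigma_{m'n'}(A)=S$, or establish that none exists. In the RAM model, memory access and elementary arithmetic operations and comparisons on integers take unit time. *)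

theory Defs
  imports Jordan_Normal_Form.Matrix
begin

section \<open>The window problem with upper constraints\<close>

definition window_sum :: "nat \<Rightarrow> nat \<Rightarrow> int mat \<Rightarrow> int mat" where
  "window_sum m' n' A =
     mat (dim_row A - m' + 1) (dim_col A - n' + 1)
       (\<lambda>(i, j). \<Sum>a<m'. \<Sum>b<n'. A $$ (i + a, j + b))"

text \<open>The order on matrices is the library's: equal dimensions and entrywise comparison.\<close>

definition window_solution :: "nat \<Rightarrow> nat \<Rightarrow> int mat \<Rightarrow> int mat \<Rightarrow> int mat \<Rightarrow> bool" where
  "window_solution m' n' S U A \<longleftrightarrow>
     0\<^sub>m (dim_row U) (dim_col U) \<le> A \<and> A \<le> U \<and> window_sum m' n' A = S"

definition U_min :: "int mat \<Rightarrow> int" where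
  "U_min U = Min (elements_mat U)"

section \<open>Random access machines\<close>

text \<open>
  A program is a finite list of instructions. The memory consists of infinitely many cells,
  addressed by natural numbers, each holding an arbitrary integer and initially 0. Besides this
  there are a read-only input tape and a write-only output tape of integers. Every instruction
  takes one unit of time. Addition and subtraction are the only arithmetic operations: a unit-cost
  multiplication of unbounded integers would strengthen the machine, and an upper bound for the
  machine below also holds for a machine with additional instructions.
\<close>

datatype instr =
    Const nat int
  | Move nat nat
  | Add nat nat nat
  | Sub nat nat nat
  | Load nat nat
  | Store nat nat
  | Jump nat
  | JumpLe nat nat nat
  | Read nat
  | Write nat
  | Halt

text \<open>Program counter, memory, unread input, output so far.\<close>

type_synonym config = "nat \<times> (nat \<Rightarrow> int) \<times> int list \<times> int list"

text \<open>
  \<open>None\<close> means that there is no next configuration. Only \<open>Halt\<close> counts as regular termination;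
  a negative address, reading past the end of the input, and a program counter outside the
  program are faults.
\<close>

fun exec_instr :: "instr \<Rightarrow> config \<Rightarrow> config option" where
  "exec_instr (Const r c) (pc, M, xs, ys) = Some (pc + 1, M(r := c), xs, ys)"
| "exec_instr (Move r s) (pc, M, xs, ys) = Some (pc + 1, M(r := M s), xs, ys)"
| "exec_instr (Add r s t) (pc, M, xs, ys) = Some (pc + 1, M(r := M s + M t), xs, ys)"
| "exec_instr (Sub r s t) (pc, M, xs, ys) = Some (pc + 1, M(r := M s - M t), xs, ys)"
| "exec_instr (Load r s) (pc, M, xs, ys) =
     (if 0 \<le> M s then Some (pc + 1, M(r := M (nat (M s))), xs, ys) else None)"
| "exec_instr (Store r s) (pc, M, xs, ys) =
     (if 0 \<le> M r then Some (pc + 1, M(nat (M r) := M s), xs, ys) else None)"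
| "exec_instr (Jump l) (pc, M, xs, ys) = Some (l, M, xs, ys)"
| "exec_instr (JumpLe r s l) (pc, M, xs, ys) =
     Some (if M r \<le> M s then l else pc + 1, M, xs, ys)"
| "exec_instr (Read r) (pc, M, xs, ys) =
     (case xs of [] \<Rightarrow> None | x # xs' \<Rightarrow> Some (pc + 1, M(r := x), xs', ys))"
| "exec_instr (Write r) (pc, M, xs, ys) = Some (pc + 1, M, xs, ys @ [M r])"
| "exec_instr Halt (pc, M, xs, ys) = None"

definition ram_step :: "instr list \<Rightarrow> config \<Rightarrow> config \<Rightarrow> bool" where
  "ram_step P c c' \<longleftrightarrow> fst c < length P \<and> exec_instr (P ! fst c) c = Some c'"

definition ram_computes :: "instr list \<Rightarrow> int list \<Rightarrow> nat \<Rightarrow> int list \<Rightarrow> bool" where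
  "ram_computes P inp t out \<longleftrightarrow>
     (\<exists>pc M xs. (ram_step P ^^ t) (0, \<lambda>_. 0, inp, []) (pc, M, xs, out) \<and>
                pc < length P \<and> P ! pc = Halt)"

section \<open>Encoding of instances and answers\<close>

definition row_major :: "int mat \<Rightarrow> int list" where
  "row_major A = concat (mat_to_list A)"

definition encode_instance :: "nat \<Rightarrow> nat \<Rightarrow> int mat \<Rightarrow> int mat \<Rightarrow> int list" where
  "encode_instance m n S U = [int m, int n] @ row_major S @ row_major U"

text \<open>The first number written tells whether a solution matrix follows.\<close>

fun encode_answer :: "int mat option \<Rightarrow> int list" where
  "encode_answer None = [0]"
| "encode_answer (Some A) = 1 # row_major A"

definition correct_answer ::
    "nat \<Rightarrow> nat \<Rightarrow> int mat \<Rightarrow> int mat \<Rightarrow> int mat option \<Rightarrow> bool" where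
  "correct_answer m' n' S U ans \<longleftrightarrow>
     (case ans of
        None \<Rightarrow> \<not> (\<exists>A. window_solution m' n' S U A)
      | Some A \<Rightarrow> window_solution m' n' S U A)"

end

theory Submission
  imports Defs
begin

text \<open>
  The matrices with vanishing \<open>2 \<times> 2\<close> window sums are those of the form
  \<open>(-1) ^ (i + j) * (x i - z j)\<close>. With one solution \<open>a\<close> of the window equations at hand (the one
  whose first row and column are zero, filled in from the top left corner), every other one is
  therefore given by a potential \<open>x i\<close> for each row and \<open>z j\<close> for each column
  (\<open>border_zero_plus_potentials\<close>, \<open>potentials_exist\<close>). The bounds \<open>0 \<le> A \<le> U\<close> become constraints
  \<open>h - u \<le> x i - z j \<le> h\<close> on differences, where \<open>h\<close> is \<open>u - a\<close> at positions with even \<open>i + j\<close> and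
  \<open>a\<close> at the others.

  Such a system of \<open>2 * m * n\<close> difference constraints on \<open>m + n\<close> integers is solved by the method
  of Bellman and Ford: starting from zero, potentials are lowered just enough to repair one
  violated constraint after the other, and \<open>m + n\<close> sweeps through all constraints reach a solution if
  one exists (\<open>bellman_ford_converges\<close>, \<open>sweeps_admissible\<close>). Checking the outcome decides the
  instance: either the potentials give a matrix \<open>A\<close>, or no solution exists. A sweep takes
  \<open>O(m n)\<close> steps, so the total is \<open>O(m n (m + n))\<close>, and \<open>1 + U_min\<close> is at least 1.

  The machine program is assembled from fragments by sequencing, branching and looping. The
  predicate \<open>run\<close> combines correctness and a bound on the number of steps of a fragment, and has
  one rule for each way of composition. All loops over the matrix are instances of one fragment
  \<open>scan\<close>, and \<open>run_solver\<close> is the resulting specification of the whole program.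
\<close>

section \<open>Integer difference constraints\<close>

definition feasible :: "('v \<times> 'v) set \<Rightarrow> ('v \<Rightarrow> 'v \<Rightarrow> int) \<Rightarrow> ('v \<Rightarrow> int) \<Rightarrow> bool" where
  "feasible E w p \<longleftrightarrow> (\<forall>(u, v) \<in> E. p v \<le> p u + w u v)"

text \<open>
  Among the solutions of the constraints that lie below the starting values there is a greatest
  one, \<open>p\<close>; it bounds all later values from below. Call a vertex tight once its value has come down
  to \<open>p\<close>. If a sweep created no new tight vertex, then every edge from a tight to another vertex
  would have slack at least 1 under \<open>p\<close>, since an edge without slack makes its head tight; and
  the values at all vertices that are not tight would be at least 1 above \<open>p\<close>. By integrality \<open>p\<close> could then be
  raised by 1 on all of them, against its maximality. So each sweep adds a tight vertex until all
  of them are tight. The three hypotheses on a sweep hold for any order of the relaxations.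
\<close>

lemma bellman_ford_converges:
  fixes d :: "nat \<Rightarrow> 'v \<Rightarrow> int"
  assumes fin: "finite V" and E: "E \<subseteq> V \<times> V"
    and decreasing: "\<And>k v. v \<in> V \<Longrightarrow> d (Suc k) v \<le> d k v"
    and relaxed: "\<And>k u v. (u, v) \<in> E \<Longrightarrow> d (Suc k) v \<le> d k u + w u v"
    and above: "\<And>k p. feasible E w p \<Longrightarrow> \<forall>v\<in>V. p v \<le> d k v \<Longrightarrow> \<forall>v\<in>V. p v \<le> d (Suc k) v"
    and q: "feasible E w q"
  shows "feasible E w (d (card V))"
proof -
  define good where "good p \<longleftrightarrow> feasible E w p \<and> (\<forall>v\<in>V. p v \<le> d 0 v)" for p
  (* The greatest solution below d 0 is found as one of minimal total distance from d 0;
     lowering q by c produces some solution below d 0. *)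
  define gap where "gap p = nat (\<Sum>v\<in>V. d 0 v - p v)" for p
  define c where "c = (\<Sum>v\<in>V. \<bar>q v - d 0 v\<bar>)"
  have "good (\<lambda>v. q v - c)"
  proof -
    have "q v - c \<le> d 0 v" if "v \<in> V" for v
    proof -
      have "\<bar>q v - d 0 v\<bar> \<le> c"
        unfolding c_def by (rule member_le_sum) (use fin that in auto)
      then show ?thesis by linarith
    qed
    then show ?thesis using q by (auto simp: good_def feasible_def)
  qed
  then obtain p where p: "good p" and least: "\<And>p'. good p' \<Longrightarrow> gap p \<le> gap p'"
    using exists_least_iff[of "\<lambda>k. \<exists>p. good p \<and> gap p = k"]
    by (metis leI)
  have p_le: "p v \<le> d k v" if "v \<in> V" for k v
  proof -
    have "\<forall>v\<in>V. p v \<le> d k v"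
      by (induction k) (use p above in \<open>auto simp: good_def\<close>)
    then show ?thesis using that by blast
  qed
  have d_le: "d k v \<le> d 0 v" if "v \<in> V" for k v
    by (induction k) (use decreasing[OF that] in \<open>auto intro: order_trans\<close>)
  define tight where "tight k = {v \<in> V. d k v = p v}" for k
  have tight_V: "tight k \<subseteq> V" and tight_fin: "finite (tight k)" for k
    using fin by (auto simp: tight_def)
  have mono: "tight k \<subseteq> tight (Suc k)" for k
  proof
    fix v assume v: "v \<in> tight k"
    then have "v \<in> V" "d k v = p v" by (auto simp: tight_def)
    then show "v \<in> tight (Suc k)"
      using decreasing[of v k] p_le[of v "Suc k"] by (simp add: tight_def)
  qed
  have grows: "tight k \<noteq> tight (Suc k)" if not_V: "tight k \<noteq> V" for k
  proof
    assume eq: "tight k = tight (Suc k)"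
    (* The raised solution that contradicts the choice of p. *)
    define p' where "p' v = (if v \<in> V - tight k then p v + 1 else p v)" for v
    have "p' v \<le> p' u + w u v" if uv: "(u, v) \<in> E" for u v
    proof -
      have le: "p v \<le> p u + w u v" using p uv by (auto simp: good_def feasible_def)
      show ?thesis
      proof (cases "v \<in> V - tight k \<and> u \<in> tight k")
        case True
        have "p v \<noteq> p u + w u v"
        proof
          assume "p v = p u + w u v"
          then have "d (Suc k) v \<le> p v" using relaxed[OF uv, of k] True by (simp add: tight_def)
          then have "v \<in> tight (Suc k)"
            using p_le[of v "Suc k"] True by (simp add: tight_def)
          then show False using True eq by blast
        qed
        then show ?thesis using le by (simp add: p'_def)
      next
        case False
        then show ?thesis using le E uv by (auto simp: p'_def)
      qed
    qed
    moreover have p'_le: "p' v \<le> d 0 v" if v: "v \<in> V" for v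
      using p_le[OF v, of k] d_le[OF v, of k] v by (auto simp: p'_def tight_def)
    ultimately have "good p'" by (auto simp: good_def feasible_def)
    obtain v0 where v0: "v0 \<in> V" "v0 \<notin> tight k" using not_V tight_V by blast
    have "(\<Sum>v\<in>V. d 0 v - p' v) < (\<Sum>v\<in>V. d 0 v - p v)"
      by (rule sum_strict_mono_ex1) (use fin v0 in \<open>auto simp: p'_def\<close>)
    moreover have "0 \<le> (\<Sum>v\<in>V. d 0 v - p' v)"
      using p'_le by (intro sum_nonneg) auto
    ultimately have "gap p' < gap p" by (simp add: gap_def)
    then show False using least[OF \<open>good p'\<close>] by simp
  qed
  have "min k (card V) \<le> card (tight k)" for k
  proof (induction k)
    case (Suc k)
    show ?case
    proof (cases "tight k = V")
      case True
      then have "tight (Suc k) = V" using mono[of k] tight_V[of "Suc k"] by simp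
      then show ?thesis by simp
    next
      case False
      then have "card (tight k) < card (tight (Suc k))"
        using mono grows tight_fin by (meson psubsetI psubset_card_mono)
      then show ?thesis using Suc by simp
    qed
  qed simp
  from this[of "card V"] have "tight (card V) = V"
    using tight_V fin by (intro card_subset_eq) (auto simp: card_mono antisym)
  then have "d (card V) v = p v" if "v \<in> V" for v using that by (auto simp: tight_def)
  then have final: "d (card V) v = p v" if "(u, v) \<in> E \<or> (v, u) \<in> E" for u v
    using that E by blast
  show ?thesis
    unfolding feasible_def
  proof safe
    fix u v assume uv: "(u, v) \<in> E"
    then have "p v \<le> p u + w u v" using p by (auto simp: good_def feasible_def)
    then show "d (card V) v \<le> d (card V) u + w u v"
      using final[of u v] final[of v u] uv by simp
  qed
qed

type_synonym potentials = "(nat \<Rightarrow> int) \<times> (nat \<Rightarrow> int)"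

text \<open>
  Matrix entries are addressed by their row-major position \<open>q\<close>, so that entry \<open>q\<close> lies in row
  \<open>q div n\<close> and column \<open>q mod n\<close>. A pair \<open>(x, z)\<close> gives a potential to each row and each column, and
  the entry imposes \<open>h q - u q \<le> x i - z j \<le> h q\<close>. Relaxing an entry repairs its two inequalities
  one after the other, by lowering first the potential of the row and then that of the column.
\<close>

definition relax :: "nat \<Rightarrow> (nat \<Rightarrow> int) \<Rightarrow> (nat \<Rightarrow> int) \<Rightarrow> nat \<Rightarrow> potentials \<Rightarrow> potentials" where
  "relax n h u q = (\<lambda>(x, z).
     let x' = x(q div n := min (x (q div n)) (z (q mod n) + h q))
     in (x', z(q mod n := min (z (q mod n)) (x' (q div n) - h q + u q))))"

definition sweep :: "nat \<Rightarrow> (nat \<Rightarrow> int) \<Rightarrow> (nat \<Rightarrow> int) \<Rightarrow> nat \<Rightarrow> potentials \<Rightarrow> potentials" where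
  "sweep n h u k = fold (relax n h u) [0..<k]"

lemma sweep_0 [simp]: "sweep n h u 0 d = d"
  by (simp add: sweep_def)

lemma sweep_Suc [simp]: "sweep n h u (Suc k) d = relax n h u k (sweep n h u k d)"
  by (simp add: sweep_def)

lemma relax_le:
  "fst (relax n h u q d) i \<le> fst d i" "snd (relax n h u q d) j \<le> snd d j"
  by (auto simp: relax_def Let_def split: prod.splits)

lemma sweep_le:
  "fst (sweep n h u k d) i \<le> fst d i" "snd (sweep n h u k d) j \<le> snd d j"
  by (induction k) (auto intro: order_trans relax_le)

lemma sweep_relaxed:
  assumes "q < k"
  shows "fst (sweep n h u k d) (q div n) \<le> snd d (q mod n) + h q"
    and "snd (sweep n h u k d) (q mod n) \<le> fst d (q div n) - h q + u q"
proof -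
  have "fst (sweep n h u k d) (q div n) \<le> snd d (q mod n) + h q \<and>
        snd (sweep n h u k d) (q mod n) \<le> fst d (q div n) - h q + u q"
    using assms
  proof (induction k)
    case (Suc k)
    show ?case
    proof (cases "q = k")
      case True
      show ?thesis
        using sweep_le(1)[of n h u k d "q div n"] sweep_le(2)[of n h u k d "q mod n"] True
        by (auto simp: relax_def Let_def split: prod.splits)
    next
      case False
      then show ?thesis
        using Suc relax_le(1)[of n h u k "sweep n h u k d" "q div n"]
          relax_le(2)[of n h u k "sweep n h u k d" "q mod n"] by simp
    qed
  qed simp
  then show "fst (sweep n h u k d) (q div n) \<le> snd d (q mod n) + h q"
    and "snd (sweep n h u k d) (q mod n) \<le> fst d (q div n) - h q + u q" by auto
qed

definition admissible :: "nat \<Rightarrow> (nat \<Rightarrow> int) \<Rightarrow> (nat \<Rightarrow> int) \<Rightarrow> nat \<Rightarrow> potentials \<Rightarrow> bool" where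
  "admissible n h u N d \<longleftrightarrow> (\<forall>q<N. h q - u q \<le> fst d (q div n) - snd d (q mod n) \<and>
                                   fst d (q div n) - snd d (q mod n) \<le> h q)"

text \<open>
  Lowering the larger side of a violated inequality as little as possible cannot overtake a pair of
  potentials that satisfies the inequality.
\<close>

lemma sweep_above:
  assumes "admissible n h u N p" "k \<le> N"
    and "n > 0" "N = m * n"
    and "\<And>i. i < m \<Longrightarrow> fst p i \<le> fst d i" "\<And>j. j < n \<Longrightarrow> snd p j \<le> snd d j"
  shows "(\<forall>i<m. fst p i \<le> fst (sweep n h u k d) i) \<and> (\<forall>j<n. snd p j \<le> snd (sweep n h u k d) j)"
  using \<open>k \<le> N\<close>
proof (induction k)
  case 0
  then show ?case using assms by simp
next
  case (Suc k)
  have "k div n < m" using Suc.prems assms by (simp add: less_mult_imp_div_less)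
  moreover have "k mod n < n" using assms by simp
  moreover have "h k - u k \<le> fst p (k div n) - snd p (k mod n)"
    "fst p (k div n) - snd p (k mod n) \<le> h k"
    using assms(1) Suc.prems by (auto simp: admissible_def)
  ultimately show ?case using Suc
    by (fastforce simp: relax_def Let_def split: prod.splits)
qed

text \<open>
  The inequalities are the edges of a bipartite graph on the \<open>m\<close> rows and \<open>n\<close> columns, in which a
  sweep relaxes every edge once. Hence \<open>m + n\<close> sweeps reach a solution whenever there is one.
\<close>

lemma sweeps_admissible:
  assumes n: "n > 0" and ex: "admissible n h u (m * n) p"
  shows "admissible n h u (m * n) ((sweep n h u (m * n) ^^ (m + n)) d)"
proof -
  define E where "E = {(Inr j, Inl i) | i j. i < m \<and> j < n} \<union> {(Inl i, Inr j) | i j. i < m \<and> j < n}"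
  define V where "V = Inl ` {..<m} \<union> (Inr ` {..<n} :: (nat + nat) set)"
  define w where "w a b = (case (a, b) of (Inr j, Inl i) \<Rightarrow> h (i * n + j)
      | (Inl i, Inr j) \<Rightarrow> u (i * n + j) - h (i * n + j) | _ \<Rightarrow> 0)" for a b :: "nat + nat"
  define D where "D k = (sweep n h u (m * n) ^^ k) d" for k
  define f where "f (d :: potentials) = case_sum (fst d) (snd d)" for d
  have pos: "i * n + j < m * n" if "i < m" "j < n" for i j
  proof -
    have "i * n + j < Suc i * n" using that by simp
    also have "\<dots> \<le> m * n" using that by (intro mult_right_mono) auto
    finally show ?thesis .
  qed
  have adm_iff: "admissible n h u (m * n) d \<longleftrightarrow> feasible E w (f d)" for d
  proof
    assume a: "admissible n h u (m * n) d"
    have "h (i * n + j) - u (i * n + j) \<le> fst d i - snd d j \<and> fst d i - snd d j \<le> h (i * n + j)"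
      if "i < m" "j < n" for i j
      using a[unfolded admissible_def, rule_format, OF pos[OF that]] that by simp
    then show "feasible E w (f d)" by (fastforce simp: feasible_def E_def w_def f_def)
  next
    assume a: "feasible E w (f d)"
    show "admissible n h u (m * n) d"
      unfolding admissible_def
    proof (intro allI impI)
      fix q assume "q < m * n"
      then have "q div n < m" "q mod n < n" using n by (auto simp: less_mult_imp_div_less)
      then have "(Inr (q mod n), Inl (q div n)) \<in> E" "(Inl (q div n), Inr (q mod n)) \<in> E"
        by (auto simp: E_def)
      from this[THEN bspec[OF a[unfolded feasible_def]]]
      show "h q - u q \<le> fst d (q div n) - snd d (q mod n) \<and>
            fst d (q div n) - snd d (q mod n) \<le> h q"
        by (simp add: w_def f_def)
    qed
  qed
  have card: "card V = m + n"
    unfolding V_def by (subst card_Un_disjoint) (auto simp: card_image)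
  have f_Inl [simp]: "f d (Inl i) = fst d i" and f_Inr [simp]: "f d (Inr j) = snd d j" for d i j
    by (auto simp: f_def)
  have "feasible E w (f (D (card V)))"
  proof (rule bellman_ford_converges[where d = "\<lambda>k. f (D k)" and V = V and q = "f p"])
    show "finite V" "E \<subseteq> V \<times> V" by (auto simp: V_def E_def)
    show "f (D (Suc k)) v \<le> f (D k) v" for k v
      by (cases v) (auto simp: D_def sweep_le)
    show "f (D (Suc k)) v \<le> f (D k) u' + w u' v" if "(u', v) \<in> E" for k u' v
    proof -
      from that consider i j where "i < m" "j < n" "u' = Inr j" "v = Inl i"
        | i j where "i < m" "j < n" "u' = Inl i" "v = Inr j" by (auto simp: E_def)
      then show ?thesis
      proof cases
        case (1 i j)
        then show ?thesis
          using sweep_relaxed(1)[OF pos[OF 1(1,2)], of n h u "D k"] by (simp add: w_def D_def)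
      next
        case (2 i j)
        then show ?thesis
          using sweep_relaxed(2)[OF pos[OF 2(1,2)], of n h u "D k"] by (simp add: w_def D_def)
      qed
    qed
    show "\<forall>v\<in>V. p' v \<le> f (D (Suc k)) v"
      if feas: "feasible E w p'" and le: "\<forall>v\<in>V. p' v \<le> f (D k) v" for k p'
    proof -
      define pp where "pp = (\<lambda>i. p' (Inl i), \<lambda>j. p' (Inr j))"
      have "f pp = p'" by (rule ext) (simp add: f_def pp_def split: sum.splits)
      then have "admissible n h u (m * n) pp" using feas adm_iff by simp
      moreover have "fst pp i \<le> fst (D k) i" if "i < m" for i
        using bspec[OF le, of "Inl i"] that by (simp add: V_def pp_def)
      moreover have "snd pp j \<le> snd (D k) j" if "j < n" for j
        using bspec[OF le, of "Inr j"] that by (simp add: V_def pp_def)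
      ultimately have "(\<forall>i<m. fst pp i \<le> fst (D (Suc k)) i) \<and> (\<forall>j<n. snd pp j \<le> snd (D (Suc k)) j)"
        using sweep_above[of n h u "m * n" pp "m * n" m "D k"] n by (simp add: D_def)
      then show ?thesis by (auto simp: V_def pp_def)
    qed
    show "feasible E w (f p)" using ex adm_iff by simp
  qed
  then show ?thesis using adm_iff card by (simp add: D_def)
qed

section \<open>Matrices with prescribed window sums\<close>

text \<open>
  The solution of the window equations whose first row and first column vanish: the equation of a
  window determines its bottom right entry.
\<close>

fun border_zero :: "int mat \<Rightarrow> nat \<Rightarrow> nat \<Rightarrow> int" where
  "border_zero S 0 j = 0"
| "border_zero S (Suc i) 0 = 0"
| "border_zero S (Suc i) (Suc j) =
     S $$ (i, j) - border_zero S i (Suc j) - border_zero S i j - border_zero S (Suc i) j"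

lemma window_sum_2_2_iff:
  assumes S: "S \<in> carrier_mat (m - 1) (n - 1)" and A: "A \<in> carrier_mat m n" and "m \<ge> 2" "n \<ge> 2"
  shows "window_sum 2 2 A = S \<longleftrightarrow>
    (\<forall>i j. Suc i < m \<longrightarrow> Suc j < n \<longrightarrow>
       A $$ (i, j) + A $$ (i, Suc j) + A $$ (Suc i, j) + A $$ (Suc i, Suc j) = S $$ (i, j))"
proof -
  have d: "Suc (m - 2) = m - Suc 0" "Suc (n - 2) = n - Suc 0" using assms by auto
  have sum2: "(\<Sum>a<2. f a) = f 0 + f (Suc 0)" for f :: "nat \<Rightarrow> int"
    by (simp add: numeral_2_eq_2)
  show ?thesis
    using S A
    by (auto simp: window_sum_def sum2 mat_eq_iff d less_diff_conv add.assoc)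
qed

text \<open>
  The alternating matrices \<open>(-1) ^ (i + j) * (x i - z j)\<close> have vanishing window sums, because
  each potential occurs twice in a window, with opposite signs.
\<close>

lemma border_zero_plus_potentials:
  assumes "\<And>i j. i < m \<Longrightarrow> j < n \<Longrightarrow>
      A $$ (i, j) = border_zero S i j + (-1) ^ (i + j) * (x i - z j)"
    and "Suc i < m" "Suc j < n"
  shows "A $$ (i, j) + A $$ (i, Suc j) + A $$ (Suc i, j) + A $$ (Suc i, Suc j) = S $$ (i, j)"
  using assms(1)[of i j] assms(1)[of i "Suc j"] assms(1)[of "Suc i" j] assms(1)[of "Suc i" "Suc j"]
    assms(2,3)
  by (simp add: algebra_simps)

text \<open>
  Conversely, the window equations determine a matrix from its first row and first column, and
  row and column potentials can be chosen to match any prescribed values there.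
\<close>

lemma potentials_exist:
  assumes eq: "\<And>i j. Suc i < m \<Longrightarrow> Suc j < n \<Longrightarrow>
      A $$ (i, j) + A $$ (i, Suc j) + A $$ (Suc i, j) + A $$ (Suc i, Suc j) = S $$ (i, j)"
  shows "\<exists>x z. \<forall>i<m. \<forall>j<n. A $$ (i, j) = border_zero S i j + (-1) ^ (i + j) * (x i - z j)"
proof -
  (* The constant A (0, 0), which rows and columns share, is put into the column potentials. *)
  define x where "x i = (-1) ^ i * A $$ (i, 0)" for i
  define z where "z j = A $$ (0, 0) - (-1) ^ j * A $$ (0, j)" for j
  have sq: "(-1) ^ k * ((-1) ^ k * a) = a" for k and a :: int
    by (simp flip: power_add mult.assoc)
  have "A $$ (i, j) = border_zero S i j + (-1) ^ (i + j) * (x i - z j)" if "i < m" "j < n" for i j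
    using that eq
  proof (induction S i j rule: border_zero.induct)
    case (1 S j)
    then show ?case by (simp add: x_def z_def algebra_simps sq)
  next
    case (2 S i)
    then show ?case by (simp add: x_def z_def algebra_simps sq)
  next
    case (3 S i j)
    have corner: "A $$ (Suc i, Suc j) = S $$ (i, j) - A $$ (i, j) - A $$ (i, Suc j) - A $$ (Suc i, j)"
      using "3.prems"(3)[of i j] "3.prems"(1,2) by simp
    have "A $$ (i, j) = border_zero S i j + (-1) ^ (i + j) * (x i - z j)"
      "A $$ (i, Suc j) = border_zero S i (Suc j) + (-1) ^ (i + Suc j) * (x i - z (Suc j))"
      "A $$ (Suc i, j) = border_zero S (Suc i) j + (-1) ^ (Suc i + j) * (x (Suc i) - z j)"
      using "3.IH" "3.prems" by simp_all
    then show ?case unfolding corner by (simp add: algebra_simps)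
  qed
  then show ?thesis by blast
qed

section \<open>Row-major order\<close>

lemma upt_grid:
  "[0..<m * n] = concat (map (\<lambda>i. map (\<lambda>j. i * n + j) [0..<n]) [0..<m])"
proof (induction m)
  case (Suc m)
  have "[0..<Suc m * n] = [0..<m * n] @ [m * n..<m * n + n]"
    by (metis add.commute le_add1 mult_Suc upt_add_eq_append zero_le)
  moreover have "[m * n..<m * n + n] = map (\<lambda>j. m * n + j) [0..<n]"
    using map_add_upt[of "m * n" n] by (simp add: add.commute)
  ultimately show ?case using Suc by simp
qed simp

lemma row_major_eq:
  assumes "A \<in> carrier_mat m n"
  shows "row_major A = map (\<lambda>q. A $$ (q div n, q mod n)) [0..<m * n]"
  using assms
  by (auto simp: upt_grid row_major_def mat_to_list_def map_concat o_def intro!: arg_cong[of _ _ concat])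

text \<open>
  The positions outside the first row and column, where a window ends; these are the positions at
  which one entry of \<open>S\<close> is consumed.
\<close>

definition interior :: "nat \<Rightarrow> nat \<Rightarrow> bool" where
  "interior n q \<longleftrightarrow> q div n \<noteq> 0 \<and> q mod n \<noteq> 0"

lemma row_major_interior:
  assumes S: "S \<in> carrier_mat (m - 1) (n - 1)" and "m \<ge> 1" "n \<ge> 1"
  shows "row_major S =
    map (\<lambda>q. S $$ (q div n - 1, q mod n - 1)) (filter (interior n) [0..<m * n])"
proof -
  obtain m' n' where mn: "m = Suc m'" "n = Suc n'" using assms by (metis Suc_le_D One_nat_def)
  have row0: "filter (interior n) (map ((+) 0) [0..<n]) = []"
    by (auto simp: filter_empty_conv interior_def)
  have row: "map (\<lambda>q. S $$ (q div n - 1, q mod n - 1))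
      (filter (interior n) (map (\<lambda>j. Suc i * n + j) [0..<n])) = map (\<lambda>j. S $$ (i, j)) [0..<n']" for i
  proof -
    have dm: "(Suc i * n + Suc j) div n = Suc i" "(Suc i * n + Suc j) mod n = Suc j" if "j < n'" for j
    proof -
      have "Suc j < n" using that by (simp add: mn)
      then show "(Suc i * n + Suc j) div n = Suc i" "(Suc i * n + Suc j) mod n = Suc j"
        by (simp_all only: div_mult_self3 mod_mult_self3 div_less mod_less)
    qed
    have "[0..<n] = 0 # map Suc [0..<n']" unfolding mn by (metis map_Suc_upt upt_conv_Cons zero_less_Suc)
    then have "map (\<lambda>j. Suc i * n + j) [0..<n] =
        (Suc i * n + 0) # map (\<lambda>j. Suc i * n + Suc j) [0..<n']"
      by (simp only: list.map map_map o_def)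
    moreover have "\<not> interior n (Suc i * n + 0)"
      by (simp add: interior_def)
    moreover have "filter (interior n) (map (\<lambda>j. Suc i * n + Suc j) [0..<n']) =
       map (\<lambda>j. Suc i * n + Suc j) [0..<n']"
    proof (rule filter_True, intro ballI)
      fix q assume "q \<in> set (map (\<lambda>j. Suc i * n + Suc j) [0..<n'])"
      then obtain j where j: "j < n'" "q = Suc i * n + Suc j" by auto
      show "interior n q" unfolding interior_def j(2) dm[OF j(1)] by simp
    qed
    ultimately have "filter (interior n) (map (\<lambda>j. Suc i * n + j) [0..<n]) =
       map (\<lambda>j. Suc i * n + Suc j) [0..<n']" by (simp only: filter.simps if_False)
    then have "map (\<lambda>q. S $$ (q div n - 1, q mod n - 1))
        (filter (interior n) (map (\<lambda>j. Suc i * n + j) [0..<n])) =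
      map (\<lambda>j. S $$ ((Suc i * n + Suc j) div n - 1, (Suc i * n + Suc j) mod n - 1)) [0..<n']"
      by (simp only: map_map o_def)
    also have "\<dots> = map (\<lambda>j. S $$ (i, j)) [0..<n']"
    proof (rule map_cong[OF refl])
      fix j assume "j \<in> set [0..<n']"
      then have "j < n'" by simp
      show "S $$ ((Suc i * n + Suc j) div n - 1, (Suc i * n + Suc j) mod n - 1) = S $$ (i, j)"
        unfolding dm[OF \<open>j < n'\<close>] by simp
    qed
    finally show ?thesis .
  qed
  have "[0..<m] = 0 # map Suc [0..<m']" unfolding mn by (metis map_Suc_upt upt_conv_Cons zero_less_Suc)
  then have "map (\<lambda>q. S $$ (q div n - 1, q mod n - 1)) (filter (interior n) [0..<m * n]) =
     concat (map (\<lambda>i. map (\<lambda>q. S $$ (q div n - 1, q mod n - 1))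
      (filter (interior n) (map (\<lambda>j. Suc i * n + j) [0..<n]))) [0..<m'])"
    by (simp add: upt_grid filter_concat map_concat o_def row0)
  also have "\<dots> = concat (map (\<lambda>i. map (\<lambda>j. S $$ (i, j)) [0..<n']) [0..<m'])"
    by (simp only: row)
  finally show ?thesis using S by (simp add: row_major_def mat_to_list_def mn)
qed

section \<open>Compositional verification of timed machine code\<close>

type_synonym state = "(nat \<Rightarrow> int) \<times> int list \<times> int list"

text \<open>
  Jump targets are absolute, so a code fragment is a function of the address at which it is placed.
\<close>

type_synonym code = "nat \<Rightarrow> instr list"

text \<open>
  Started at its first instruction in state \<open>s\<close>, fragment \<open>c\<close> leaves at its end after at most \<open>t\<close>
  steps in a state satisfying \<open>R\<close>. Quantifying over the surrounding program is what makes the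
  property compositional; as a predicate transformer in \<open>R\<close> it lets programs be verified from
  the end to the beginning.
\<close>

definition run :: "code \<Rightarrow> nat \<Rightarrow> state \<Rightarrow> (state \<Rightarrow> bool) \<Rightarrow> bool" where
  "run c t s R \<longleftrightarrow>
     (\<forall>pre post. \<exists>t' s'. t' \<le> t \<and> R s' \<and>
        (ram_step (pre @ c (length pre) @ post) ^^ t')
          (length pre, s) (length pre + length (c (length pre)), s'))"

lemma run_weaken:
  assumes "run c t s R" "t \<le> t'" "\<And>s. R s \<Longrightarrow> R' s"
  shows "run c t' s R'"
  unfolding run_def
proof (intro allI)
  fix pre post :: "instr list"
  obtain k s' where "k \<le> t" "R s'" "(ram_step (pre @ c (length pre) @ post) ^^ k)
     (length pre, s) (length pre + length (c (length pre)), s')"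
    using assms(1) unfolding run_def by blast
  then show "\<exists>k s'. k \<le> t' \<and> R' s' \<and> (ram_step (pre @ c (length pre) @ post) ^^ k)
     (length pre, s) (length pre + length (c (length pre)), s')"
    using assms(2,3) by (meson order_trans)
qed

definition block :: "instr list \<Rightarrow> code" where
  "block is l = is"

definition seq :: "code \<Rightarrow> code \<Rightarrow> code" (infixr ";;" 60) where
  "(c1 ;; c2) l = c1 l @ c2 (l + length (c1 l))"

text \<open>
  The second branch is placed first, because the machine falls through to it when the test fails.
\<close>

definition if_le :: "nat \<Rightarrow> nat \<Rightarrow> code \<Rightarrow> code \<Rightarrow> code" where
  "if_le r s c1 c2 l =
     (let no = c2 (l + 1); l1 = l + length no + 2; yes = c1 l1
      in JumpLe r s l1 # no @ Jump (l1 + length yes) # yes)"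

definition while_less :: "nat \<Rightarrow> nat \<Rightarrow> code \<Rightarrow> code" where
  "while_less r s c l =
     (let body = c (l + 1)
      in JumpLe s r (l + length body + 2) # body @ [Jump l])"

lemma run_skip: "R s \<Longrightarrow> run (block []) t s R"
  unfolding run_def block_def by (intro allI exI[of _ 0] exI[of _ s]) auto

lemma ram_step_at:
  assumes "exec_instr (P ! pc) (pc, s) = Some c" "pc < length P"
  shows "ram_step P (pc, s) c"
  using assms by (simp add: ram_step_def)

lemma run_seq:
  assumes "run c1 t1 s (\<lambda>s'. run c2 t2 s' R)" "t1 + t2 \<le> t"
  shows "run (c1 ;; c2) t s R"
  unfolding run_def
proof (intro allI)
  fix pre post :: "instr list"
  let ?a = "c1 (length pre)"
  let ?b = "c2 (length pre + length ?a)"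
  obtain k1 s1 where 1: "k1 \<le> t1" "run c2 t2 s1 R"
    "(ram_step (pre @ ?a @ ?b @ post) ^^ k1) (length pre, s) (length pre + length ?a, s1)"
    using assms(1) unfolding run_def by blast
  obtain k2 s2 where 2: "k2 \<le> t2" "R s2"
    "(ram_step ((pre @ ?a) @ c2 (length (pre @ ?a)) @ post) ^^ k2) (length (pre @ ?a), s1)
       (length (pre @ ?a) + length (c2 (length (pre @ ?a))), s2)"
    using 1(2) unfolding run_def by blast
  have "(ram_step (pre @ ?a @ ?b @ post) ^^ (k1 + k2)) (length pre, s)
      (length pre + length ?a + length ?b, s2)"
    using 1(3) 2(3) by (auto simp: relpowp_add)
  then show "\<exists>t' s'. t' \<le> t \<and> R s' \<and>
      (ram_step (pre @ (c1 ;; c2) (length pre) @ post) ^^ t')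
        (length pre, s) (length pre + length ((c1 ;; c2) (length pre)), s')"
    using 1(1) 2(1,2) assms(2)
    by (intro exI[of _ "k1 + k2"] exI[of _ s2]) (auto simp: seq_def add.assoc)
qed

lemma run_if_le:
  assumes "M r \<le> M s \<Longrightarrow> run c1 t (M, io) R"
    and "\<not> M r \<le> M s \<Longrightarrow> run c2 t (M, io) R"
    and "t + 2 \<le> T"
  shows "run (if_le r s c1 c2) T (M, io) R"
  unfolding run_def
proof (intro allI)
  fix pre post :: "instr list"
  obtain xs ys where io: "io = (xs, ys)" by (cases io)
  define no where "no = c2 (length pre + 1)"
  define l1 where "l1 = length pre + length no + 2"
  define yes where "yes = c1 l1"
  define code where "code = if_le r s c1 c2 (length pre)"
  have code: "code = JumpLe r s l1 # no @ Jump (l1 + length yes) # yes"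
    by (simp add: code_def if_le_def no_def l1_def yes_def Let_def)
  let ?P = "pre @ code @ post"
  have len: "length pre + length code = l1 + length yes" by (simp add: code l1_def)
  have first: "ram_step ?P (length pre, M, io) (if M r \<le> M s then l1 else length pre + 1, M, io)"
    by (rule ram_step_at) (auto simp: code io)
  have "\<exists>t' s'. t' \<le> T \<and> R s' \<and> (ram_step ?P ^^ t') (length pre, M, io) (l1 + length yes, s')"
  proof (cases "M r \<le> M s")
    case True
    let ?pre = "pre @ JumpLe r s l1 # no @ [Jump (l1 + length yes)]"
    have l: "length ?pre = l1" by (simp add: l1_def)
    obtain k s' where k: "k \<le> t" "R s'"
      "(ram_step (?pre @ c1 (length ?pre) @ post) ^^ k) (length ?pre, M, io)
         (length ?pre + length (c1 (length ?pre)), s')"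
      using assms(1)[OF True] unfolding run_def by blast
    have eq: "?pre @ c1 (length ?pre) @ post = ?P" unfolding l by (simp add: code yes_def)
    have mid: "(ram_step ?P ^^ k) (l1, M, io) (l1 + length yes, s')"
      using k(3)[unfolded eq] unfolding l unfolding yes_def .
    have "(ram_step ?P ^^ Suc k) (length pre, M, io) (l1 + length yes, s')"
      by (rule relpowp_Suc_I2[OF _ mid]) (use first True in simp)
    then show ?thesis using k assms(3) by (intro exI[of _ "Suc k"] exI[of _ s']) auto
  next
    case False
    let ?pre = "pre @ [JumpLe r s l1]"
    let ?post = "Jump (l1 + length yes) # yes @ post"
    have l: "length ?pre = length pre + 1" by simp
    obtain k s' where k: "k \<le> t" "R s'"
      "(ram_step (?pre @ c2 (length ?pre) @ ?post) ^^ k) (length ?pre, M, io)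
         (length ?pre + length (c2 (length ?pre)), s')"
      using assms(2)[OF False] unfolding run_def by blast
    have eq: "?pre @ c2 (length ?pre) @ ?post = ?P" unfolding l by (simp add: code no_def)
    have mid: "(ram_step ?P ^^ k) (length pre + 1, M, io) (length pre + 1 + length no, s')"
      using k(3)[unfolded eq] unfolding l no_def .
    obtain M' xs' ys' where s': "s' = (M', xs', ys')" by (cases s')
    have "ram_step ?P (length pre + 1 + length no, s') (l1 + length yes, s')"
      by (rule ram_step_at) (auto simp: code s' nth_append)
    from relpowp_Suc_I[OF mid this]
    have "(ram_step ?P ^^ Suc (Suc k)) (length pre, M, io) (l1 + length yes, s')"
      by (rule relpowp_Suc_I2[rotated]) (use first False in simp)
    then show ?thesis using k assms(3) by (intro exI[of _ "Suc (Suc k)"] exI[of _ s']) auto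
  qed
  then show "\<exists>t' s'. t' \<le> T \<and> R s' \<and>
      (ram_step (pre @ if_le r s c1 c2 (length pre) @ post) ^^ t')
        (length pre, M, io) (length pre + length (if_le r s c1 c2 (length pre)), s')"
    using len by (simp add: code_def)
qed

text \<open>
  The counter \<open>k\<close> of the invariant fixes the number \<open>N\<close> of iterations in advance; every iteration
  pays two steps for the test and the jump back, and the final test costs one more.
\<close>

lemma run_while_less:
  assumes body: "\<And>k M io. k < N \<Longrightarrow> I k (M, io) \<Longrightarrow> M r < M s \<and> run c t (M, io) (I (Suc k))"
    and exit: "\<And>M io. I N (M, io) \<Longrightarrow> \<not> M r < M s"
    and start: "I 0 st"
    and result: "\<And>s. I N s \<Longrightarrow> R s"
    and time: "N * (t + 2) + 1 \<le> T"
  shows "run (while_less r s c) T st R"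
  unfolding run_def
proof (intro allI)
  fix pre post :: "instr list"
  define b where "b = c (length pre + 1)"
  define l1 where "l1 = length pre + length b + 2"
  define code where "code = while_less r s c (length pre)"
  have code: "code = JumpLe s r l1 # b @ [Jump (length pre)]"
    by (simp add: code_def while_less_def b_def l1_def Let_def)
  let ?P = "pre @ code @ post"
  have test: "ram_step ?P (length pre, M, io) (if M s \<le> M r then l1 else length pre + 1, M, io)"
    for M io by (cases io, rule ram_step_at) (auto simp: code)
  have once: "\<exists>k' s'. k' \<le> t + 2 \<and> I (Suc k) s' \<and> (ram_step ?P ^^ k') (length pre, x) (length pre, s')"
    if k: "k < N" and inv: "I k x" for k x
  proof -
    obtain M io where x: "x = (M, io)" by (cases x)
    let ?pre = "pre @ [JumpLe s r l1]"
    let ?post = "Jump (length pre) # post"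
    have l: "length ?pre = length pre + 1" by simp
    have less: "M r < M s" and r: "run c t (M, io) (I (Suc k))"
      using body[OF k] inv x by auto
    obtain k' s' where k': "k' \<le> t" "I (Suc k) s'"
      "(ram_step (?pre @ c (length ?pre) @ ?post) ^^ k') (length ?pre, M, io)
         (length ?pre + length (c (length ?pre)), s')"
      using r unfolding run_def by blast
    have eq: "?pre @ c (length ?pre) @ ?post = ?P" unfolding l by (simp add: code b_def)
    have mid: "(ram_step ?P ^^ k') (length pre + 1, M, io) (length pre + 1 + length b, s')"
      using k'(3)[unfolded eq] unfolding l b_def .
    obtain M' xs' ys' where s': "s' = (M', xs', ys')" by (cases s')
    have "ram_step ?P (length pre + 1 + length b, s') (length pre, s')"
      by (rule ram_step_at) (auto simp: code s' nth_append)
    from relpowp_Suc_I[OF mid this]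
    have "(ram_step ?P ^^ Suc (Suc k')) (length pre, x) (length pre, s')"
      by (rule relpowp_Suc_I2[rotated]) (use test[of M io] less x in simp)
    then show ?thesis using k' by (intro exI[of _ "Suc (Suc k')"] exI[of _ s']) auto
  qed
  have "\<exists>k' s'. k' \<le> k * (t + 2) \<and> I k s' \<and> (ram_step ?P ^^ k') (length pre, st) (length pre, s')"
    if "k \<le> N" for k
    using that
  proof (induction k)
    case 0
    then show ?case using start by (intro exI[of _ 0] exI[of _ st]) auto
  next
    case (Suc k)
    then obtain k1 s1 where 1: "k1 \<le> k * (t + 2)" "I k s1"
      "(ram_step ?P ^^ k1) (length pre, st) (length pre, s1)" by auto
    obtain k2 s2 where 2: "k2 \<le> t + 2" "I (Suc k) s2"
      "(ram_step ?P ^^ k2) (length pre, s1) (length pre, s2)"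
      using once[OF _ 1(2)] Suc.prems by auto
    have "(ram_step ?P ^^ (k1 + k2)) (length pre, st) (length pre, s2)"
      using 1(3) 2(3) by (auto simp: relpowp_add)
    then show ?case using 1 2 by (intro exI[of _ "k1 + k2"] exI[of _ s2]) auto
  qed
  from this[OF le_refl] obtain k' s' where k': "k' \<le> N * (t + 2)" "I N s'"
    "(ram_step ?P ^^ k') (length pre, st) (length pre, s')" by blast
  obtain M io where s': "s' = (M, io)" by (cases s')
  have "ram_step ?P (length pre, s') (l1, s')"
    using test[of M io] exit[of M io] k'(2) s' by auto
  from relpowp_Suc_I[OF k'(3) this]
  have "(ram_step ?P ^^ Suc k') (length pre, st) (l1, s')" .
  moreover have "length pre + length code = l1" by (simp add: code l1_def)
  ultimately show "\<exists>t' s'. t' \<le> T \<and> R s' \<and>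
      (ram_step (pre @ while_less r s c (length pre) @ post) ^^ t')
        (length pre, st) (length pre + length (while_less r s c (length pre)), s')"
    using k' time result by (intro exI[of _ "Suc k'"] exI[of _ s']) (auto simp: code_def)
qed

text \<open>
  Weakest preconditions of straight-line code. Requiring the successor address \<open>pc + 1\<close> for every \<open>pc\<close>
  excludes jumps.
\<close>

primrec wp :: "instr list \<Rightarrow> (state \<Rightarrow> bool) \<Rightarrow> state \<Rightarrow> bool" where
  "wp [] R s = R s"
| "wp (i # is) R s = (\<exists>s'. (\<forall>pc. exec_instr i (pc, s) = Some (pc + 1, s')) \<and> wp is R s')"

lemma wp_simps [simp]:
  "wp (Const r c # is) R (M, xs, ys) = wp is R (M(r := c), xs, ys)"
  "wp (Move r s # is) R (M, xs, ys) = wp is R (M(r := M s), xs, ys)"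
  "wp (Add r s t # is) R (M, xs, ys) = wp is R (M(r := M s + M t), xs, ys)"
  "wp (Sub r s t # is) R (M, xs, ys) = wp is R (M(r := M s - M t), xs, ys)"
  "wp (Load r s # is) R (M, xs, ys) = (0 \<le> M s \<and> wp is R (M(r := M (nat (M s))), xs, ys))"
  "wp (Store r s # is) R (M, xs, ys) = (0 \<le> M r \<and> wp is R (M(nat (M r) := M s), xs, ys))"
  "wp (Read r # is) R (M, x # xs, ys) = wp is R (M(r := x), xs, ys)"
  "wp (Write r # is) R (M, xs, ys) = wp is R (M, xs, ys @ [M r])"
  by auto

declare wp.simps(2) [simp del]

lemma run_block:
  assumes "wp is R s" "length is \<le> t"
  shows "run (block is) t s R"
proof -
  have "run (block is) (length is) s R"
    using assms(1)
  proof (induction "is" arbitrary: s)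
    case Nil
    then show ?case by (simp add: run_skip)
  next
    case (Cons i "is")
    then obtain s' where s': "\<And>pc. exec_instr i (pc, s) = Some (pc + 1, s')" "wp is R s'"
      by (auto simp: wp.simps(2))
    have "run (block [i]) 1 s (\<lambda>s. run (block is) (length is) s R)"
      unfolding run_def[of "block [i]"]
    proof (intro allI exI[of _ "1 :: nat"] exI[of _ s'] conjI)
      fix pre post :: "instr list"
      show "run (block is) (length is) s' R" using Cons.IH[OF s'(2)] .
      show "(ram_step (pre @ block [i] (length pre) @ post) ^^ 1)
          (length pre, s) (length pre + length (block [i] (length pre)), s')"
        using s'(1) by (simp add: block_def ram_step_def eq_OO)
    qed simp
    then have "run (block [i] ;; block is) (1 + length is) s R"
      by (rule run_seq) simp
    moreover have "block [i] ;; block is = block (i # is)"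
      by (rule ext) (simp add: block_def seq_def)
    ultimately show ?case by simp
  qed
  then show ?thesis using assms(2) run_weaken by blast
qed

lemma ram_computes_run:
  assumes "run c t (\<lambda>_. 0, inp, []) (\<lambda>(M, xs, ys). ys = out)"
  shows "\<exists>t' \<le> t. ram_computes (c 0 @ [Halt]) inp t' out"
proof -
  obtain t' s' where t': "t' \<le> t" "(\<lambda>(M, xs, ys). ys = out) s'"
    "(ram_step (c 0 @ [Halt]) ^^ t') (0, \<lambda>_. 0, inp, []) (length (c 0), s')"
    using assms[unfolded run_def, rule_format, of "[]" "[Halt]"] by auto
  obtain M xs where "s' = (M, xs, out)" using t'(2) by (cases s') auto
  then have "ram_computes (c 0 @ [Halt]) inp t' out"
    using t'(3) unfolding ram_computes_def
    by (intro exI[of _ "length (c 0)"] exI[of _ M] exI[of _ xs]) simp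
  then show ?thesis using t'(1) by blast
qed

section \<open>Arrays and scans over matrices\<close>

text \<open>
  Four unbounded arrays are interleaved above 32 registers: the potentials of the rows and of the
  columns, the upper limits \<open>h\<close> on the differences of potentials, and the matrix \<open>U\<close>. A stride of
  4 can be computed by two doublings, and no base address depends on the input.
\<close>

datatype array = Row_pot | Col_pot | Cap | Upper

primrec offset :: "array \<Rightarrow> nat" where
  "offset Row_pot = 0" | "offset Col_pot = 1" | "offset Cap = 2" | "offset Upper = 3"

definition cell :: "array \<Rightarrow> nat \<Rightarrow> nat" where
  "cell a i = 32 + 4 * i + offset a"

lemma offset_less: "offset a < 4"
  by (cases a) auto

lemma cell_eq_iff [simp]: "cell a i = cell b j \<longleftrightarrow> a = b \<and> i = j"
proof
  assume "cell a i = cell b j"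
  then have eq: "4 * i + offset a = 4 * j + offset b" by (simp add: cell_def)
  then have "i = j" using offset_less[of a] offset_less[of b] by linarith
  moreover from this eq have "a = b" by (cases a; cases b) auto
  ultimately show "a = b \<and> i = j" by simp
qed simp

lemma cell_neq_register [simp]: "r < 32 \<Longrightarrow> cell a i \<noteq> r" "r < 32 \<Longrightarrow> r \<noteq> cell a i"
  by (auto simp: cell_def)

abbreviation (input) "r_addr \<equiv> 20 :: nat"
abbreviation (input) "r_base \<equiv> 21 :: nat"
abbreviation (input) "r_m \<equiv> 2 :: nat"
abbreviation (input) "r_n \<equiv> 3 :: nat"
abbreviation (input) "r_one \<equiv> 4 :: nat"
abbreviation (input) "r_zero \<equiv> 5 :: nat"
abbreviation (input) "r_row \<equiv> 6 :: nat"
abbreviation (input) "r_col \<equiv> 7 :: nat"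
abbreviation (input) "r_pos \<equiv> 8 :: nat"
abbreviation (input) "r_par \<equiv> 9 :: nat"
abbreviation (input) "r_rowpar \<equiv> 10 :: nat"
abbreviation (input) "r_round \<equiv> 11 :: nat"
abbreviation (input) "r_rounds \<equiv> 12 :: nat"
abbreviation (input) "r_ok \<equiv> 13 :: nat"
abbreviation (input) "r_t \<equiv> 14 :: nat"
abbreviation (input) "r_u \<equiv> 15 :: nat"
abbreviation (input) "r_v \<equiv> 16 :: nat"

definition address :: "array \<Rightarrow> nat \<Rightarrow> instr list" where
  "address a s = [Add r_addr s s, Add r_addr r_addr r_addr,
     Const r_base (32 + int (offset a)), Add r_addr r_addr r_base]"

definition get :: "nat \<Rightarrow> array \<Rightarrow> nat \<Rightarrow> instr list" where
  "get r a s = address a s @ [Load r r_addr]"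

definition put :: "array \<Rightarrow> nat \<Rightarrow> nat \<Rightarrow> instr list" where
  "put a s r = address a s @ [Store r_addr r]"

lemma length_get [simp]: "length (get r a s) = 5" and length_put [simp]: "length (put a s r) = 5"
  by (auto simp: get_def put_def address_def)

lemma wp_get [simp]:
  assumes "0 \<le> M s"
  shows "wp (get r a s @ is) R (M, xs, ys) \<longleftrightarrow>
    wp is R (M(r_addr := int (cell a (nat (M s))), r_base := 32 + int (offset a),
               r := M (cell a (nat (M s)))), xs, ys)"
proof -
  have "M s + M s + (M s + M s) + (32 + int (offset a)) = int (cell a (nat (M s)))"
    using assms by (simp add: cell_def)
  then show ?thesis
    by (simp add: get_def address_def fun_upd_twist)
qed

lemma wp_put [simp]:
  assumes "0 \<le> M s" "r \<noteq> r_addr" "r \<noteq> r_base"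
  shows "wp (put a s r @ is) R (M, xs, ys) \<longleftrightarrow>
    wp is R (M(r_addr := int (cell a (nat (M s))), r_base := 32 + int (offset a),
               cell a (nat (M s)) := M r), xs, ys)"
proof -
  have "M s + M s + (M s + M s) + (32 + int (offset a)) = int (cell a (nat (M s)))"
    using assms by (simp add: cell_def)
  then show ?thesis
    using assms(2,3) by (simp add: put_def address_def fun_upd_twist)
qed

lemma wp_get' [simp]:
  "0 \<le> M s \<Longrightarrow> wp (get r a s) R (M, xs, ys) \<longleftrightarrow>
    R (M(r_addr := int (cell a (nat (M s))), r_base := 32 + int (offset a),
         r := M (cell a (nat (M s)))), xs, ys)"
  using wp_get[of M s r a "[]" R xs ys] by simp

lemma wp_put' [simp]:
  "\<lbrakk>0 \<le> M s; r \<noteq> r_addr; r \<noteq> r_base\<rbrakk> \<Longrightarrow> wp (put a s r) R (M, xs, ys) \<longleftrightarrow>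
    R (M(r_addr := int (cell a (nat (M s))), r_base := 32 + int (offset a),
         cell a (nat (M s)) := M r), xs, ys)"
  using wp_put[of M s r a "[]" R xs ys] by simp

text \<open>
  One loop that visits all entries in row-major order replaces two nested ones. The register
  \<open>r_par\<close> holds the parity of \<open>i + j\<close>, which is found without division by toggling it along a row;
  \<open>r_rowpar\<close> restores it at the start of the next row.
\<close>

definition scan :: "code \<Rightarrow> code" where
  "scan body =
     block [Const r_pos 0, Const r_row 0, Const r_col 0, Const r_par 0, Const r_rowpar 0] ;;
     while_less r_row r_m
       (body ;;
        block [Add r_pos r_pos r_one, Add r_col r_col r_one, Sub r_par r_one r_par] ;;
        if_le r_n r_col
          (block [Const r_col 0, Add r_row r_row r_one, Sub r_rowpar r_one r_rowpar,
                  Move r_par r_rowpar])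
          (block []))"

definition env :: "nat \<Rightarrow> nat \<Rightarrow> (nat \<Rightarrow> int) \<Rightarrow> bool" where
  "env m n M \<longleftrightarrow> M r_m = int m \<and> M r_n = int n \<and> M r_one = 1 \<and> M r_zero = 0"

definition at_entry :: "nat \<Rightarrow> nat \<Rightarrow> nat \<Rightarrow> (nat \<Rightarrow> int) \<Rightarrow> bool" where
  "at_entry m n q M \<longleftrightarrow> env m n M \<and> M r_pos = int q \<and> M r_row = int (q div n) \<and>
     M r_col = int (q mod n) \<and> M r_par = of_bool (odd (q div n + q mod n)) \<and>
     M r_rowpar = of_bool (odd (q div n))"

definition scan_stable :: "(state \<Rightarrow> bool) \<Rightarrow> bool" where
  "scan_stable I \<longleftrightarrow> (\<forall>M xs ys r v. r \<in> {r_row, r_col, r_pos, r_par, r_rowpar} \<longrightarrow>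
     I (M, xs, ys) \<longrightarrow> I (M(r := v), xs, ys))"

text \<open>
  Verifying a scan is reduced to verifying its body at a single entry. The body has to leave the
  loop registers alone, and the invariant must not depend on them.
\<close>

lemma run_scan:
  assumes n: "n > 0"
    and body: "\<And>q M xs ys. q < m * n \<Longrightarrow> at_entry m n q M \<Longrightarrow> I q (M, xs, ys) \<Longrightarrow>
      run body t (M, xs, ys) (\<lambda>(M, xs, ys). at_entry m n q M \<and> I (Suc q) (M, xs, ys))"
    and stable: "\<And>q. scan_stable (I q)"
    and start: "env m n M" "I 0 (M, xs, ys)"
    and result: "\<And>M xs ys. env m n M \<Longrightarrow> I (m * n) (M, xs, ys) \<Longrightarrow> R (M, xs, ys)"
    and time: "m * n * (t + 11) + 6 \<le> T"
  shows "run (scan body) T (M, xs, ys) R"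
proof -
  define J where "J q = (\<lambda>(M, xs, ys). at_entry m n q M \<and> I q (M, xs, ys))" for q
  have upd: "I q (M(r := v), xs, ys)"
    if "I q (M, xs, ys)" "r \<in> {r_row, r_col, r_pos, r_par, r_rowpar}" for q M r v xs ys
    using stable[of q] that unfolding scan_stable_def by blast
  have advance: "run (block [Add r_pos r_pos r_one, Add r_col r_col r_one, Sub r_par r_one r_par] ;;
        if_le r_n r_col
          (block [Const r_col 0, Add r_row r_row r_one, Sub r_rowpar r_one r_rowpar,
                  Move r_par r_rowpar])
          (block [])) 9 (M, xs, ys) (J (Suc q))"
    if at: "at_entry m n q M" and inv: "I (Suc q) (M, xs, ys)" for q M xs ys
  proof (rule run_seq[where ?t1.0 = 3 and ?t2.0 = 6, OF run_block])
    have less: "q mod n < n" using n by simp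
    show "wp [Add r_pos r_pos r_one, Add r_col r_col r_one, Sub r_par r_one r_par]
      (\<lambda>s. run (if_le r_n r_col
          (block [Const r_col 0, Add r_row r_row r_one, Sub r_rowpar r_one r_rowpar,
                  Move r_par r_rowpar])
          (block [])) 6 s (J (Suc q))) (M, xs, ys)"
      apply simp
      apply (rule run_if_le[where t = 4])
      subgoal
        apply (rule run_block)
         apply (simp add: J_def)
        using at less
         apply (auto intro!: upd inv simp: at_entry_def env_def mod_Suc div_Suc)
        done
      subgoal
        apply (rule run_skip)
        apply (simp add: J_def)
        using at less
        apply (auto intro!: upd inv simp: at_entry_def env_def mod_Suc div_Suc)
        done
      by simp
  qed auto
  show ?thesis
    unfolding scan_def
  proof (rule run_seq[where ?t1.0 = 5 and ?t2.0 = "m * n * (t + 9 + 2) + 1", OF run_block])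
    have "run (while_less r_row r_m
       (body ;;
        block [Add r_pos r_pos r_one, Add r_col r_col r_one, Sub r_par r_one r_par] ;;
        if_le r_n r_col
          (block [Const r_col 0, Add r_row r_row r_one, Sub r_rowpar r_one r_rowpar,
                  Move r_par r_rowpar])
          (block []))) (m * n * (t + 9 + 2) + 1) s R" if "J 0 s" for s
    proof (rule run_while_less[where I = J])
      fix q M io assume q: "q < m * n" and J: "J q (M, io)"
      obtain xs ys where io: "io = (xs, ys)" by (cases io)
      have at: "at_entry m n q M" and I: "I q (M, xs, ys)" using J by (auto simp: J_def io)
      have "q div n < m" using q by (simp add: less_mult_imp_div_less)
      then have "M r_row < M r_m" using at by (simp add: at_entry_def env_def)
      moreover have "run (body ;;
        block [Add r_pos r_pos r_one, Add r_col r_col r_one, Sub r_par r_one r_par] ;;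
        if_le r_n r_col
          (block [Const r_col 0, Add r_row r_row r_one, Sub r_rowpar r_one r_rowpar,
                  Move r_par r_rowpar])
          (block [])) (t + 9) (M, io) (J (Suc q))"
        unfolding io
        by (rule run_seq[OF run_weaken[OF body[OF q at I] order_refl]]) (auto intro: advance)
      ultimately show "M r_row < M r_m \<and> run (body ;;
        block [Add r_pos r_pos r_one, Add r_col r_col r_one, Sub r_par r_one r_par] ;;
        if_le r_n r_col
          (block [Const r_col 0, Add r_row r_row r_one, Sub r_rowpar r_one r_rowpar,
                  Move r_par r_rowpar])
          (block [])) (t + 9) (M, io) (J (Suc q))" ..
    next
      fix M io assume "J (m * n) (M, io)"
      then show "\<not> M r_row < M r_m"
        using n by (auto simp: J_def at_entry_def env_def)
    next
      fix s assume "J (m * n) s"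
      then show "R s" using result by (auto simp: J_def at_entry_def)
    qed (use that in auto)
    moreover have "J 0 (M(r_pos := 0, r_row := 0, r_col := 0, r_par := 0, r_rowpar := 0), xs, ys)"
      using start by (auto simp: J_def at_entry_def env_def intro!: upd)
    ultimately show "wp [Const r_pos 0, Const r_row 0, Const r_col 0, Const r_par 0, Const r_rowpar 0]
      (\<lambda>s. run (while_less r_row r_m
       (body ;;
        block [Add r_pos r_pos r_one, Add r_col r_col r_one, Sub r_par r_one r_par] ;;
        if_le r_n r_col
          (block [Const r_col 0, Add r_row r_row r_one, Sub r_rowpar r_one r_rowpar,
                  Move r_par r_rowpar])
          (block []))) (m * n * (t + 9 + 2) + 1) s R) (M, xs, ys)" by simp
  qed (use time in \<open>auto simp: algebra_simps\<close>)
qed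

section \<open>Processing a single entry\<close>

definition holds :: "array \<Rightarrow> nat \<Rightarrow> (nat \<Rightarrow> int) \<Rightarrow> (nat \<Rightarrow> int) \<Rightarrow> bool" where
  "holds a N f M \<longleftrightarrow> (\<forall>i<N. M (cell a i) = f i)"

lemma holdsD: "holds a N f M \<Longrightarrow> i < N \<Longrightarrow> M (cell a i) = f i"
  by (simp add: holds_def)

lemma register_less_cell [simp]: "r < 32 \<Longrightarrow> r < cell a i"
  by (simp add: cell_def)

lemma holds_upd_register [simp]: "r < 32 \<Longrightarrow> holds a N f (M(r := v)) \<longleftrightarrow> holds a N f M"
  by (auto simp: holds_def)

lemma holds_upd_other [simp]: "a \<noteq> b \<Longrightarrow> holds a N f (M(cell b i := v)) \<longleftrightarrow> holds a N f M"
  by (auto simp: holds_def)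

lemma holds_upd: "holds a N f M \<Longrightarrow> holds a N (f(i := v)) (M(cell a i := v))"
  by (auto simp: holds_def)

lemma holds_upd_same:
  "holds a N f M \<Longrightarrow> M (cell a i) = v \<Longrightarrow> holds a N (f(i := v)) M"
  by (auto simp: holds_def)

lemma env_upd [simp]: "10 < r \<Longrightarrow> env m n (M(r := v)) \<longleftrightarrow> env m n M"
  by (auto simp: env_def)

lemma at_entry_upd [simp]: "10 < r \<Longrightarrow> at_entry m n q (M(r := v)) \<longleftrightarrow> at_entry m n q M"
  by (auto simp: at_entry_def)

lemma at_entryD:
  assumes "at_entry m n q M"
  shows "M r_m = int m" "M r_n = int n" "M r_one = 1" "M r_zero = 0" "M r_pos = int q"
    "M r_row = int (q div n)" "M r_col = int (q mod n)" "M r_par = of_bool (odd (q div n + q mod n))"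
  using assms by (auto simp: at_entry_def env_def)

lemma of_bool_le_0_iff [simp]: "(of_bool P :: int) \<le> 0 \<longleftrightarrow> \<not> P"
  by simp

definition layout ::
    "nat \<Rightarrow> nat \<Rightarrow> (nat \<Rightarrow> int) \<Rightarrow> (nat \<Rightarrow> int) \<Rightarrow> (nat \<Rightarrow> int) \<Rightarrow> (nat \<Rightarrow> int) \<Rightarrow> (nat \<Rightarrow> int) \<Rightarrow> bool" where
  "layout m n x z h u M \<longleftrightarrow> holds Row_pot m x M \<and> holds Col_pot n z M \<and>
     holds Cap (m * n) h M \<and> holds Upper (m * n) u M"

lemma layout_upd_register [simp]: "r < 32 \<Longrightarrow> layout m n x z h u (M(r := v)) \<longleftrightarrow> layout m n x z h u M"
  by (simp add: layout_def)

text \<open>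
  The bodies of the scans work on the entry at \<open>r_pos\<close>. The first one subtracts the upper, upper left and
  left neighbours from the next input number; it leaves the zeros in the first row and column that
  the memory initially contains.
\<close>

definition border_body :: code where
  "border_body =
     if_le r_row r_zero (block [])
      (if_le r_col r_zero (block [])
        (block (Read r_t # Sub r_v r_pos r_n # get r_u Cap r_v @
          Sub r_t r_t r_u # Sub r_v r_v r_one # get r_u Cap r_v @
          Sub r_t r_t r_u # Sub r_v r_pos r_one # get r_u Cap r_v @
          Sub r_t r_t r_u # put Cap r_pos r_t)))"

text \<open>
  Replaces the entry \<open>a\<close> of the particular solution by the limit \<open>h\<close>: at even positions
  \<open>0 \<le> a + (x - z) \<le> u\<close> says that \<open>x - z\<close> is at most \<open>u - a\<close>, at odd positions
  \<open>0 \<le> a - (x - z) \<le> u\<close> says that it is at most \<open>a\<close>. In both cases the lower limit is \<open>h - u\<close>.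
\<close>

definition caps_body :: code where
  "caps_body =
     block (Read r_u # put Upper r_pos r_u) ;;
     if_le r_par r_zero
       (block (get r_t Cap r_pos @ Sub r_t r_u r_t # put Cap r_pos r_t))
       (block [])"

definition relax_body :: code where
  "relax_body =
     block (get r_u Cap r_pos @ get r_t Col_pot r_col @ Add r_t r_t r_u # get r_v Row_pot r_row) ;;
     if_le r_v r_t (block []) (block (Move r_v r_t # put Row_pot r_row r_v)) ;;
     block (Sub r_t r_v r_u # get r_u Upper r_pos @ Add r_t r_t r_u # get r_v Col_pot r_col) ;;
     if_le r_v r_t (block []) (block (put Col_pot r_col r_t))"

text \<open>
  The slack \<open>u - h + x - z\<close> above the lower limit lies between \<open>0\<close> and \<open>u\<close> exactly if the entry is
  admissible. It equals the entry of the answer at even positions, and \<open>u\<close> minus that entry at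
  odd ones. The answer overwrites the limit.
\<close>

definition answer_body :: code where
  "answer_body =
     block (get r_u Upper r_pos @ get r_t Cap r_pos @ Sub r_t r_u r_t # get r_v Row_pot r_row @
       Add r_t r_t r_v # get r_v Col_pot r_col @ [Sub r_t r_t r_v]) ;;
     if_le r_zero r_t (if_le r_t r_u (block []) (block [Const r_ok 0])) (block [Const r_ok 0]) ;;
     if_le r_par r_zero (block []) (block [Sub r_t r_u r_t]) ;;
     block (put Cap r_pos r_t)"

definition write_body :: code where
  "write_body = block (get r_t Cap r_pos @ [Write r_t])"

definition program :: code where
  "program =
     block [Read r_m, Read r_n, Const r_one 1, Const r_zero 0] ;;
     scan border_body ;;
     scan caps_body ;;
     block [Add r_rounds r_m r_n, Const r_round 0] ;;
     while_less r_round r_rounds (scan relax_body ;; block [Add r_round r_round r_one]) ;;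
     block [Const r_ok 1] ;;
     scan answer_body ;;
     if_le r_one r_ok (block [Write r_one] ;; scan write_body) (block [Write r_zero])"

definition border_entry :: "int mat \<Rightarrow> nat \<Rightarrow> nat \<Rightarrow> int" where
  "border_entry S n q = border_zero S (q div n) (q mod n)"

lemma prefix_upd: "(\<lambda>p. if p < Suc q then f p else g p) = (\<lambda>p. if p < q then f p else g p)(q := f q)"
  by (auto simp: fun_eq_iff less_Suc_eq)

lemma run_border_body:
  assumes q: "q < m * n" and at: "at_entry m n q M"
    and lay: "layout m n x z (\<lambda>p. if p < q then border_entry S n p else 0) u M"
    and xs: "xs = map (\<lambda>q. S $$ (q div n - 1, q mod n - 1)) (filter (interior n) [q..<m * n]) @ rest"
  shows "run border_body 40 (M, xs, ys) (\<lambda>(M, xs, ys'). at_entry m n q M \<and>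
    layout m n x z (\<lambda>p. if p < Suc q then border_entry S n p else 0) u M \<and>
    xs = map (\<lambda>q. S $$ (q div n - 1, q mod n - 1)) (filter (interior n) [Suc q..<m * n]) @ rest \<and>
    ys' = ys)"
proof -
  note [simp] = at_entryD[OF at]
  have skip: "border_entry S n q = 0" "\<not> interior n q" if "q div n = 0 \<or> q mod n = 0"
    using that by (cases "q div n"; auto simp: border_entry_def interior_def)+
  have cap: "M (cell Cap p) = (if p < q then border_entry S n p else 0)" if "p < m * n" for p
    using lay that by (simp add: layout_def holds_def)
  have unchanged: "layout m n x z (\<lambda>p. if p < Suc q then border_entry S n p else 0) u M"
    if "border_entry S n q = 0"
  proof -
    have "(\<lambda>p. if p < Suc q then border_entry S n p else 0) =
      (\<lambda>p. if p < q then border_entry S n p else 0)"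
      using that by (auto simp: fun_eq_iff less_Suc_eq)
    then show ?thesis using lay by simp
  qed
  show ?thesis
    unfolding border_body_def
  proof (rule run_if_le[where t = 38])
    assume "M r_row \<le> M r_zero"
    then have "q div n = 0 \<or> q mod n = 0" by simp
    then show "run (block []) 38 (M, xs, ys) (\<lambda>(M, xs, ys'). at_entry m n q M \<and>
      layout m n x z (\<lambda>p. if p < Suc q then border_entry S n p else 0) u M \<and>
      xs = map (\<lambda>q. S $$ (q div n - 1, q mod n - 1)) (filter (interior n) [Suc q..<m * n]) @ rest \<and>
      ys' = ys)"
      using at unchanged skip xs by (intro run_skip) (simp add: upt_conv_Cons[OF q])
  next
    assume row: "\<not> M r_row \<le> M r_zero"
    show "run (if_le r_col r_zero (block [])
        (block (Read r_t # Sub r_v r_pos r_n # get r_u Cap r_v @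
          Sub r_t r_t r_u # Sub r_v r_v r_one # get r_u Cap r_v @
          Sub r_t r_t r_u # Sub r_v r_pos r_one # get r_u Cap r_v @
          Sub r_t r_t r_u # put Cap r_pos r_t))) 38 (M, xs, ys) (\<lambda>(M, xs, ys'). at_entry m n q M \<and>
      layout m n x z (\<lambda>p. if p < Suc q then border_entry S n p else 0) u M \<and>
      xs = map (\<lambda>q. S $$ (q div n - 1, q mod n - 1)) (filter (interior n) [Suc q..<m * n]) @ rest \<and>
      ys' = ys)"
    proof (rule run_if_le[where t = 36])
      assume "M r_col \<le> M r_zero"
      then have "q div n = 0 \<or> q mod n = 0" by simp
      then show "run (block []) 36 (M, xs, ys) (\<lambda>(M, xs, ys'). at_entry m n q M \<and>
        layout m n x z (\<lambda>p. if p < Suc q then border_entry S n p else 0) u M \<and>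
        xs = map (\<lambda>q. S $$ (q div n - 1, q mod n - 1)) (filter (interior n) [Suc q..<m * n]) @ rest \<and>
        ys' = ys)"
        using at unchanged skip xs by (intro run_skip) (simp add: upt_conv_Cons[OF q])
    next
      assume col: "\<not> M r_col \<le> M r_zero"
      obtain i j where i: "q div n = Suc i" and j: "q mod n = Suc j"
        using row col by (metis at_entryD[OF at] not0_implies_Suc of_nat_0 order_refl)
      have q_eq: "q = i * n + n + Suc j"
        using div_mult_mod_eq[of q n] i j by simp
      have jn: "Suc j < n" using j q by (metis mod_less_divisor mult_0_right gr0I not_less0)
      have entries: "border_entry S n (q - n) = border_zero S i (Suc j)"
        "border_entry S n (q - n - 1) = border_zero S i j"
        "border_entry S n (q - 1) = border_zero S (Suc i) j"
      proof -
        have "q - n = i * n + Suc j" "q - n - 1 = i * n + j" "q - 1 = Suc i * n + j"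
          by (simp_all add: q_eq)
        moreover have "(i * n + Suc j) div n = i" "(i * n + Suc j) mod n = Suc j"
          "(i * n + j) div n = i" "(i * n + j) mod n = j"
          "(Suc i * n + j) div n = Suc i" "(Suc i * n + j) mod n = j"
          using jn by (simp_all only: div_mult_self3 mod_mult_self3 div_less mod_less Suc_lessD)
        ultimately show "border_entry S n (q - n) = border_zero S i (Suc j)"
          "border_entry S n (q - n - 1) = border_zero S i j"
          "border_entry S n (q - 1) = border_zero S (Suc i) j"
          by (simp_all only: border_entry_def)
      qed
      have pos: "int q - int n = int (q - n)" "int (q - n) - 1 = int (q - n - 1)"
        "int q - 1 = int (q - 1)" "q - n < q" "q - n - 1 < q" "q - 1 < q"
        using jn by (simp_all add: q_eq)
      have vals: "M (cell Cap (q - n)) = border_zero S i (Suc j)"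
        "M (cell Cap (q - n - 1)) = border_zero S i j"
        "M (cell Cap (q - 1)) = border_zero S (Suc i) j"
        using cap pos(4-6) q entries by simp_all
      have new: "border_entry S n q = S $$ (i, j) - border_zero S i (Suc j) - border_zero S i j -
          border_zero S (Suc i) j"
        by (simp add: border_entry_def i j)
      have "interior n q" by (simp add: interior_def i j)
      then have xs': "xs = S $$ (i, j) #
          map (\<lambda>q. S $$ (q div n - 1, q mod n - 1)) (filter (interior n) [Suc q..<m * n]) @ rest"
        by (simp add: xs upt_conv_Cons[OF q] i j)
      show "run (block (Read r_t # Sub r_v r_pos r_n # get r_u Cap r_v @
          Sub r_t r_t r_u # Sub r_v r_v r_one # get r_u Cap r_v @
          Sub r_t r_t r_u # Sub r_v r_pos r_one # get r_u Cap r_v @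
          Sub r_t r_t r_u # put Cap r_pos r_t)) 36 (M, xs, ys) (\<lambda>(M, xs, ys'). at_entry m n q M \<and>
        layout m n x z (\<lambda>p. if p < Suc q then border_entry S n p else 0) u M \<and>
        xs = map (\<lambda>q. S $$ (q div n - 1, q mod n - 1)) (filter (interior n) [Suc q..<m * n]) @ rest \<and>
        ys' = ys)"
        apply (rule run_block)
         apply (simp add: xs' pos(1-3) vals vals[simplified] at)
        using lay unfolding layout_def prefix_upd
         apply (auto simp: new intro!: holds_upd)
        done
    qed simp
  qed simp
qed

lemma run_caps_body:
  assumes q: "q < m * n" and at: "at_entry m n q M"
    and lay: "layout m n x z (\<lambda>p. if p < q then c p else a p) (\<lambda>p. if p < q then u p else 0) M"
    and c: "c q = (if even (q div n + q mod n) then u q - a q else a q)"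
  shows "run caps_body 20 (M, map u [q..<m * n], ys) (\<lambda>(M, xs, ys'). at_entry m n q M \<and>
    layout m n x z (\<lambda>p. if p < Suc q then c p else a p) (\<lambda>p. if p < Suc q then u p else 0) M \<and>
    xs = map u [Suc q..<m * n] \<and> ys' = ys)"
proof -
  note [simp] = at_entryD[OF at]
  have cap: "M (cell Cap q) = a q" using lay q by (simp add: layout_def holds_def)
  show ?thesis
    unfolding caps_body_def
    apply (rule run_seq[where ?t1.0 = 6 and ?t2.0 = 14, OF run_block])
      apply (simp add: upt_conv_Cons[OF q])
      apply (rule run_if_le[where t = 12])
    subgoal
      apply (rule run_block)
       apply (simp add: cap at)
      using lay c unfolding layout_def prefix_upd
       apply (auto intro!: holds_upd)
      done
    subgoal
      apply (rule run_skip)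
      apply (simp add: cap at)
      using lay c cap unfolding layout_def prefix_upd
      apply (auto intro!: holds_upd holds_upd_same)
      done
    apply auto
    done
qed

text \<open>
  The two conditional updates are verified one after the other, with \<open>mid\<close> describing the state
  between them; this is where \<open>x'\<close> is complete and \<open>z\<close> is still the old function.
\<close>

lemma run_relax_body:
  assumes q: "q < m * n" and at: "at_entry m n q M"
    and lay: "layout m n (fst d) (snd d) h u M"
    and rounds: "M r_round = k" "M r_rounds = K"
  shows "run relax_body 50 (M, xs, ys) (\<lambda>(M, xs', ys'). at_entry m n q M \<and>
    layout m n (fst (relax n h u q d)) (snd (relax n h u q d)) h u M \<and>
    M r_round = k \<and> M r_rounds = K \<and> xs' = xs \<and> ys' = ys)"
proof -
  note [simp] = at_entryD[OF at]
  obtain x z where d: "d = (x, z)" by (cases d)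
  define i j where "i = q div n" and "j = q mod n"
  have "n > 0" using q by (cases n) auto
  then have ij: "i < m" "j < n" using q by (auto simp: i_def j_def less_mult_imp_div_less)
  have vals: "M (cell Row_pot i) = x i" "M (cell Col_pot j) = z j" "M (cell Cap q) = h q"
    "M (cell Upper q) = u q"
    using lay q ij by (auto simp: layout_def holds_def d)
  define x' where "x' = x(i := min (x i) (z j + h q))"
  define z' where "z' = z(j := min (z j) (x' i - h q + u q))"
  have relax: "fst (relax n h u q d) = x'" "snd (relax n h u q d) = z'"
    by (simp_all add: relax_def d Let_def x'_def z'_def i_def j_def)
  have h: "holds Cap (m * n) h M" and u: "holds Upper (m * n) u M"
    and hx: "holds Row_pot m x M" and hz: "holds Col_pot n z M"
    using lay by (auto simp: layout_def d)
  define mid where "mid = (\<lambda>(M', xs', ys'). at_entry m n q M' \<and> layout m n x' z h u M' \<and>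
     M' r_v = x' i \<and> M' r_u = h q \<and> M' r_round = k \<and> M' r_rounds = K \<and> xs' = xs \<and> ys' = ys)"
  have "run (block (Sub r_t r_v r_u # get r_u Upper r_pos @ Add r_t r_t r_u # get r_v Col_pot r_col) ;;
     if_le r_v r_t (block []) (block (put Col_pot r_col r_t))) 20 s
    (\<lambda>(M, xs', ys'). at_entry m n q M \<and>
    layout m n (fst (relax n h u q d)) (snd (relax n h u q d)) h u M \<and>
    M r_round = k \<and> M r_rounds = K \<and> xs' = xs \<and> ys' = ys)" if mid: "mid s" for s
  proof -
    obtain M' where s: "s = (M', xs, ys)" using mid by (cases s) (auto simp: mid_def)
    have at': "at_entry m n q M'" and regs: "M' r_v = x' i" "M' r_u = h q" "M' r_round = k" "M' r_rounds = K"
      and hold: "holds Row_pot m x' M'" "holds Col_pot n z M'" "holds Cap (m * n) h M'"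
        "holds Upper (m * n) u M'"
      using mid by (auto simp: mid_def s layout_def)
    have vals': "M' (cell Col_pot j) = z j" "M' (cell Upper q) = u q"
      using hold q ij by (auto simp: holds_def)
    show ?thesis
      unfolding s
      apply (rule run_seq[where ?t1.0 = 12 and ?t2.0 = 8, OF run_block])
        apply (simp add: at_entryD[OF at'] regs vals' flip: i_def j_def)
        apply (rule run_if_le[where t = 6])
      subgoal
        apply (rule run_skip)
        using at' hold
        apply (simp add: relax layout_def regs z'_def min_def)
        done
      subgoal
        apply (rule run_block)
         apply (simp add: at_entryD[OF at'] at' flip: i_def j_def)
        using hold
         apply (auto simp: relax layout_def regs z'_def min_def intro!: holds_upd)
        done
        apply auto
      done
  qed
  note second = this
  have "run (block (get r_u Cap r_pos @ get r_t Col_pot r_col @ Add r_t r_t r_u # get r_v Row_pot r_row) ;;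
     if_le r_v r_t (block []) (block (Move r_v r_t # put Row_pot r_row r_v))) 25 (M, xs, ys) mid"
    apply (rule run_seq[where ?t1.0 = 16 and ?t2.0 = 9, OF run_block])
      apply (simp add: vals flip: i_def j_def)
      apply (rule run_if_le[where t = 6])
    subgoal
      apply (rule run_skip)
      apply (simp add: mid_def at layout_def h u hx hz rounds x'_def min_def)
      done
    subgoal
      apply (rule run_block)
       apply (simp add: mid_def at layout_def h u hz rounds x'_def flip: i_def j_def)
       apply (auto simp: min_def hx intro!: holds_upd)
      done
      apply auto
    done
  from run_seq[OF run_weaken[OF this order_refl second], of 50]
  have "run ((block (get r_u Cap r_pos @ get r_t Col_pot r_col @ Add r_t r_t r_u # get r_v Row_pot r_row) ;;
     if_le r_v r_t (block []) (block (Move r_v r_t # put Row_pot r_row r_v))) ;;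
     block (Sub r_t r_v r_u # get r_u Upper r_pos @ Add r_t r_t r_u # get r_v Col_pot r_col) ;;
     if_le r_v r_t (block []) (block (put Col_pot r_col r_t))) 50 (M, xs, ys) (\<lambda>(M, xs', ys'). at_entry m n q M \<and>
    layout m n (fst (relax n h u q d)) (snd (relax n h u q d)) h u M \<and>
    M r_round = k \<and> M r_rounds = K \<and> xs' = xs \<and> ys' = ys)"
    by simp
  moreover have "(c1 ;; c2) ;; c3 = c1 ;; c2 ;; c3" for c1 c2 c3
    by (rule ext) (simp add: seq_def add.assoc)
  ultimately show ?thesis unfolding relax_body_def by simp
qed

definition slack :: "nat \<Rightarrow> (nat \<Rightarrow> int) \<Rightarrow> (nat \<Rightarrow> int) \<Rightarrow> potentials \<Rightarrow> nat \<Rightarrow> int" where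
  "slack n h u d q = u q - h q + fst d (q div n) - snd d (q mod n)"

definition answer_entry :: "nat \<Rightarrow> (nat \<Rightarrow> int) \<Rightarrow> (nat \<Rightarrow> int) \<Rightarrow> potentials \<Rightarrow> nat \<Rightarrow> int" where
  "answer_entry n h u d q =
     (if even (q div n + q mod n) then slack n h u d q else u q - slack n h u d q)"

lemma run_answer_body:
  assumes q: "q < m * n" and at: "at_entry m n q M"
    and lay: "layout m n (fst d) (snd d) (\<lambda>p. if p < q then answer_entry n h u d p else h p) u M"
    and ok: "M r_ok = of_bool (admissible n h u q d)"
  shows "run answer_body 50 (M, xs, ys) (\<lambda>(M, xs', ys'). at_entry m n q M \<and>
    layout m n (fst d) (snd d) (\<lambda>p. if p < Suc q then answer_entry n h u d p else h p) u M \<and>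
    M r_ok = of_bool (admissible n h u (Suc q) d) \<and> xs' = xs \<and> ys' = ys)"
proof -
  note [simp] = at_entryD[OF at]
  define i j where "i = q div n" and "j = q mod n"
  have "n > 0" using q by (cases n) auto
  then have ij: "i < m" "j < n" using q by (auto simp: i_def j_def less_mult_imp_div_less)
  have vals: "M (cell Row_pot i) = fst d i" "M (cell Col_pot j) = snd d j" "M (cell Cap q) = h q"
    "M (cell Upper q) = u q"
    using lay q ij by (auto simp: layout_def holds_def)
  define e where "e = slack n h u d q"
  have e: "u q - h q + fst d i - snd d j = e" by (simp add: e_def slack_def i_def j_def)
  have adm: "admissible n h u (Suc q) d \<longleftrightarrow> admissible n h u q d \<and> 0 \<le> e \<and> e \<le> u q"
    unfolding admissible_def e_def slack_def by (auto simp: less_Suc_eq)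
  define b :: int where "b = of_bool (admissible n h u (Suc q) d)"
  have b: "b = of_bool (admissible n h u q d \<and> 0 \<le> e \<and> e \<le> u q)" by (simp add: b_def adm)
  have store: "run (if_le r_par r_zero (block []) (block [Sub r_t r_u r_t]) ;; block (put Cap r_pos r_t)) 20
     (M', xs, ys) (\<lambda>(M, xs', ys'). at_entry m n q M \<and>
    layout m n (fst d) (snd d) (\<lambda>p. if p < Suc q then answer_entry n h u d p else h p) u M \<and>
    M r_ok = b \<and> xs' = xs \<and> ys' = ys)"
    if at': "at_entry m n q M'"
      and lay': "layout m n (fst d) (snd d) (\<lambda>p. if p < q then answer_entry n h u d p else h p) u M'"
      and regs: "M' r_t = e" "M' r_u = u q" "M' r_ok = b" for M'
  proof -
    show ?thesis
      apply (rule run_seq[where ?t1.0 = 5 and ?t2.0 = 10])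
       apply (rule run_if_le[where t = 3])
      subgoal
        apply (rule run_skip)
        apply (rule run_block)
        using at' lay' regs
         apply (simp_all add: at_entryD[OF at'] layout_def prefix_upd answer_entry_def
            holds_upd flip: e_def)
        done
      subgoal
        apply (rule run_block)
         apply simp
         apply (rule run_block)
        using at' lay' regs
          apply (simp_all add: at_entryD[OF at'] layout_def prefix_upd answer_entry_def
            holds_upd flip: e_def)
        done
       apply auto
      done
  qed
  show ?thesis
    unfolding answer_body_def b_def[symmetric]
    apply (rule run_seq[where ?t1.0 = 23 and ?t2.0 = 26, OF run_block])
      apply (simp add: vals e flip: i_def j_def)
      apply (rule run_seq[where ?t1.0 = 6 and ?t2.0 = 20])
       apply (rule run_if_le[where t = 4])
        apply (rule run_if_le[where t = 2])
    subgoal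
      apply (rule run_skip)
      apply (rule run_weaken[OF store])
      using ok lay at by (auto simp: b)
    subgoal
      apply (rule run_block)
       apply simp
       apply (rule run_weaken[OF store])
      using ok lay at by (auto simp: b)
         apply simp
    subgoal
      apply (rule run_block)
       apply simp
       apply (rule run_weaken[OF store])
      using ok lay at by (auto simp: b)
       apply auto
    done
qed

lemma run_write_body:
  assumes q: "q < m * n" and at: "at_entry m n q M" and hold: "holds Cap (m * n) f M"
  shows "run write_body 6 (M, xs, ys @ map f [0..<q])
    (\<lambda>(M, xs', ys'). at_entry m n q M \<and> holds Cap (m * n) f M \<and> ys' = ys @ map f [0..<Suc q])"
  unfolding write_body_def
  apply (rule run_block)
  using at at_entryD[OF at] hold holdsD[OF hold q]
  by auto

section \<open>The solver\<close>

definition input_phase :: code where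
  "input_phase =
     block [Read r_m, Read r_n, Const r_one 1, Const r_zero 0] ;; scan border_body ;; scan caps_body"

definition relax_phase :: code where
  "relax_phase =
     block [Add r_rounds r_m r_n, Const r_round 0] ;;
     while_less r_round r_rounds (scan relax_body ;; block [Add r_round r_round r_one])"

definition answer_phase :: code where
  "answer_phase = block [Const r_ok 1] ;; scan answer_body"

definition output_phase :: code where
  "output_phase =
     if_le r_one r_ok (block [Write r_one] ;; scan write_body) (block [Write r_zero])"

definition solver :: code where
  "solver = input_phase ;; relax_phase ;; answer_phase ;; output_phase"

definition cap_entry :: "int mat \<Rightarrow> nat \<Rightarrow> (nat \<Rightarrow> int) \<Rightarrow> nat \<Rightarrow> int" where
  "cap_entry S n u q =
     (if even (q div n + q mod n) then u q - border_entry S n q else border_entry S n q)"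

lemma holds_full_prefix [simp]:
  "holds a N (\<lambda>p. if p < N then f p else g p) M \<longleftrightarrow> holds a N f M"
  by (auto simp: holds_def)

lemma layout_full_prefix [simp]:
  "layout m n x z (\<lambda>p. if p < m * n then f p else g p) u M \<longleftrightarrow> layout m n x z f u M"
  "layout m n x z h (\<lambda>p. if p < m * n then f p else g p) M \<longleftrightarrow> layout m n x z h f M"
  by (simp_all add: layout_def)

lemma run_input_phase:
  assumes n: "n > 0"
    and inp: "inp = int m # int n #
      map (\<lambda>q. S $$ (q div n - 1, q mod n - 1)) (filter (interior n) [0..<m * n]) @ map u [0..<m * n]"
  shows "run input_phase (m * n * 82 + 20) (\<lambda>_. 0, inp, []) (\<lambda>(M, xs, ys). env m n M \<and>
    layout m n (\<lambda>_. 0) (\<lambda>_. 0) (cap_entry S n u) u M \<and> ys = [])"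
proof -
  define I1 where "I1 q = (\<lambda>(M, xs, ys).
    layout m n (\<lambda>_. 0) (\<lambda>_. 0) (\<lambda>p. if p < q then border_entry S n p else 0) (\<lambda>_. 0) M \<and>
    xs = map (\<lambda>q. S $$ (q div n - 1, q mod n - 1)) (filter (interior n) [q..<m * n]) @ map u [0..<m * n] \<and>
    ys = ([] :: int list))" for q
  define I2 where "I2 q = (\<lambda>(M, xs, ys).
    layout m n (\<lambda>_. 0) (\<lambda>_. 0) (\<lambda>p. if p < q then cap_entry S n u p else border_entry S n p)
      (\<lambda>p. if p < q then u p else 0) M \<and>
    xs = map u [q..<m * n] \<and> ys = ([] :: int list))" for q
  define R where "R = (\<lambda>(M, xs :: int list, ys). env m n M \<and>
    layout m n (\<lambda>_. 0) (\<lambda>_. 0) (cap_entry S n u) u M \<and> ys = ([] :: int list))"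
  have caps: "run (scan caps_body) (m * n * 31 + 6) (M, xs, ys) R"
    if "env m n M" "I1 (m * n) (M, xs, ys)" for M xs ys
  proof (rule run_scan[OF n, where I = I2 and m = m and t = 20])
    fix q M xs ys assume q: "q < m * n" and at: "at_entry m n q M" and I: "I2 q (M, xs, ys)"
    have lay: "layout m n (\<lambda>_. 0) (\<lambda>_. 0) (\<lambda>p. if p < q then cap_entry S n u p else border_entry S n p)
        (\<lambda>p. if p < q then u p else 0) M" and io: "xs = map u [q..<m * n]" "ys = []"
      using I by (auto simp: I2_def)
    show "run caps_body 20 (M, xs, ys) (\<lambda>(M, xs, ys). at_entry m n q M \<and> I2 (Suc q) (M, xs, ys))"
      unfolding io
      by (rule run_weaken[OF run_caps_body[OF q at lay cap_entry_def] order_refl]) (simp add: I2_def split_beta)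
  next
    show "scan_stable (I2 q)" for q by (auto simp: scan_stable_def I2_def)
  next
    show "I2 0 (M, xs, ys)"
      using that(2) by (simp add: I1_def I2_def)
  next
    fix M xs ys assume "env m n M" "I2 (m * n) (M, xs, ys)"
    then show "R (M, xs, ys)" by (simp add: I2_def R_def)
  qed (use that in auto)
  have border: "run (scan border_body) (m * n * 51 + 6) (M, xs, ys)
      (\<lambda>s. run (scan caps_body) (m * n * 31 + 6) s R)"
    if "env m n M" "I1 0 (M, xs, ys)" for M xs ys
  proof (rule run_scan[OF n, where I = I1 and m = m and t = 40])
    fix q M xs ys assume q: "q < m * n" and at: "at_entry m n q M" and I: "I1 q (M, xs, ys)"
    have lay: "layout m n (\<lambda>_. 0) (\<lambda>_. 0) (\<lambda>p. if p < q then border_entry S n p else 0) (\<lambda>_. 0) M"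
      and xs: "xs = map (\<lambda>q. S $$ (q div n - 1, q mod n - 1)) (filter (interior n) [q..<m * n]) @
        map u [0..<m * n]" and ys: "ys = []"
      using I by (auto simp: I1_def)
    show "run border_body 40 (M, xs, ys) (\<lambda>(M, xs, ys). at_entry m n q M \<and> I1 (Suc q) (M, xs, ys))"
      by (rule run_weaken[OF run_border_body[OF q at lay xs] order_refl]) (simp add: I1_def ys split_beta)
  next
    show "scan_stable (I1 q)" for q by (auto simp: scan_stable_def I1_def)
  qed (use that caps in auto)
  have zero: "layout m n (\<lambda>_. 0) (\<lambda>_. 0) (\<lambda>_. 0) (\<lambda>_. 0) (\<lambda>_. 0)"
    by (simp add: layout_def holds_def)
  have "run (scan border_body ;; scan caps_body) (m * n * 82 + 16) (M, xs, ys) R"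
    if "env m n M" "I1 0 (M, xs, ys)" for M xs ys
    by (rule run_seq[OF border[OF that]]) simp
  then have "run input_phase (m * n * 82 + 20) (\<lambda>_. 0, inp, []) R"
    unfolding input_phase_def
    by (intro run_seq[where ?t1.0 = 4 and ?t2.0 = "m * n * 82 + 16", OF run_block])
      (use zero in \<open>auto simp: inp env_def I1_def\<close>)
  then show ?thesis by (simp add: R_def)
qed

lemma run_relax_phase:
  assumes n: "n > 0" and env: "env m n M" and lay: "layout m n (\<lambda>_. 0) (\<lambda>_. 0) h u M"
  shows "run relax_phase ((m + n) * (m * n * 61 + 9) + 3) (M, xs, ys) (\<lambda>(M, xs, ys'). env m n M \<and>
    (let d = (sweep n h u (m * n) ^^ (m + n)) (\<lambda>_. 0, \<lambda>_. 0) in layout m n (fst d) (snd d) h u M) \<and>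
    ys' = ys)"
proof -
  define D where "D k = (sweep n h u (m * n) ^^ k) (\<lambda>_. 0, \<lambda>_. 0)" for k
  define I where "I k d = (\<lambda>(M, xs :: int list, ys').
     layout m n (fst d) (snd d) h u M \<and> M r_round = int k \<and> M r_rounds = int (m + n) \<and> ys' = ys)"
    for k :: nat and d
  define J where "J k = (\<lambda>(M, xs, ys). env m n M \<and> I k (D k) (M, xs, ys))" for k
  have round: "run (scan relax_body ;; block [Add r_round r_round r_one]) (m * n * 61 + 7) (M, xs, zs)
      (J (Suc k))"
    if "J k (M, xs, zs)" for k M xs zs
  proof (rule run_seq[where ?t1.0 = "m * n * 61 + 6" and ?t2.0 = 1])
    show "run (scan relax_body) (m * n * 61 + 6) (M, xs, zs)
      (\<lambda>s. run (block [Add r_round r_round r_one]) 1 s (J (Suc k)))"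
    proof (rule run_scan[OF n, where I = "\<lambda>q. I k (sweep n h u q (D k))" and m = m and t = 50])
      fix q M xs ys' assume q: "q < m * n" and at: "at_entry m n q M"
        and inv: "I k (sweep n h u q (D k)) (M, xs, ys')"
      have lay: "layout m n (fst (sweep n h u q (D k))) (snd (sweep n h u q (D k))) h u M"
        and rounds: "M r_round = int k" "M r_rounds = int (m + n)" and ys: "ys' = ys"
        using inv by (auto simp: I_def)
      show "run relax_body 50 (M, xs, ys') (\<lambda>(M, xs, ys).
          at_entry m n q M \<and> I k (sweep n h u (Suc q) (D k)) (M, xs, ys))"
        by (rule run_weaken[OF run_relax_body[OF q at lay rounds] order_refl])
          (simp add: I_def ys split_beta)
    next
      show "scan_stable (I k (sweep n h u q (D k)))" for q by (auto simp: scan_stable_def I_def)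
    next
      fix M xs ys assume "env m n M" "I k (sweep n h u (m * n) (D k)) (M, xs, ys)"
      then show "run (block [Add r_round r_round r_one]) 1 (M, xs, ys) (J (Suc k))"
        by (intro run_block) (auto simp: J_def I_def D_def env_def)
    qed (use that in \<open>auto simp: J_def\<close>)
  qed simp
  show ?thesis
    unfolding relax_phase_def
  proof (rule run_seq[where ?t1.0 = 2 and ?t2.0 = "(m + n) * (m * n * 61 + 7 + 2) + 1", OF run_block])
    have "J 0 (M(r_rounds := int m + int n, r_round := 0), xs, ys)"
      using env lay by (simp add: J_def I_def D_def)
    moreover have "run (while_less r_round r_rounds (scan relax_body ;; block [Add r_round r_round r_one]))
        ((m + n) * (m * n * 61 + 7 + 2) + 1) s (\<lambda>(M, xs, ys'). env m n M \<and>
        (let d = (sweep n h u (m * n) ^^ (m + n)) (\<lambda>_. 0, \<lambda>_. 0) in layout m n (fst d) (snd d) h u M) \<and>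
        ys' = ys)" if "J 0 s" for s
    proof (rule run_while_less[where I = J])
      fix k M io assume "k < m + n" "J k (M, io)"
      then show "M r_round < M r_rounds \<and> run (scan relax_body ;; block [Add r_round r_round r_one])
          (m * n * 61 + 7) (M, io) (J (Suc k))"
        using round by (cases io) (auto simp: J_def I_def)
    qed (use that in \<open>auto simp: J_def I_def D_def Let_def\<close>)
    ultimately show "wp [Add r_rounds r_m r_n, Const r_round 0] (\<lambda>s. run
        (while_less r_round r_rounds (scan relax_body ;; block [Add r_round r_round r_one]))
        ((m + n) * (m * n * 61 + 7 + 2) + 1) s (\<lambda>(M, xs, ys'). env m n M \<and>
        (let d = (sweep n h u (m * n) ^^ (m + n)) (\<lambda>_. 0, \<lambda>_. 0) in layout m n (fst d) (snd d) h u M) \<and>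
        ys' = ys)) (M, xs, ys)"
      using env by (simp add: env_def)
  qed (simp_all add: algebra_simps)
qed

lemma run_answer_phase:
  assumes n: "n > 0" and env: "env m n M" and lay: "layout m n (fst d) (snd d) h u M"
  shows "run answer_phase (m * n * 61 + 7) (M, xs, ys) (\<lambda>(M, xs, ys'). env m n M \<and>
    holds Cap (m * n) (answer_entry n h u d) M \<and> M r_ok = of_bool (admissible n h u (m * n) d) \<and> ys' = ys)"
proof -
  define I where "I q = (\<lambda>(M, xs' :: int list, ys').
     layout m n (fst d) (snd d) (\<lambda>p. if p < q then answer_entry n h u d p else h p) u M \<and>
     M r_ok = of_bool (admissible n h u q d) \<and> ys' = ys)" for q
  have "run (scan answer_body) (m * n * 61 + 6) (M(r_ok := 1), xs, ys) (\<lambda>(M, xs, ys'). env m n M \<and>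
    holds Cap (m * n) (answer_entry n h u d) M \<and> M r_ok = of_bool (admissible n h u (m * n) d) \<and> ys' = ys)"
  proof (rule run_scan[OF n, where I = I and m = m and t = 50])
    fix q M xs ys' assume q: "q < m * n" and at: "at_entry m n q M" and inv: "I q (M, xs, ys')"
    have lay: "layout m n (fst d) (snd d) (\<lambda>p. if p < q then answer_entry n h u d p else h p) u M"
      and ok: "M r_ok = of_bool (admissible n h u q d)" and ys: "ys' = ys"
      using inv by (auto simp: I_def)
    show "run answer_body 50 (M, xs, ys') (\<lambda>(M, xs, ys). at_entry m n q M \<and> I (Suc q) (M, xs, ys))"
      by (rule run_weaken[OF run_answer_body[OF q at lay ok] order_refl])
        (simp add: I_def ys split_beta)
  next
    show "scan_stable (I q)" for q by (auto simp: scan_stable_def I_def)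
  next
    fix M xs ys' assume "env m n M" "I (m * n) (M, xs, ys')"
    then show "case (M, xs, ys') of (M, xs, ys') \<Rightarrow> env m n M \<and>
        holds Cap (m * n) (answer_entry n h u d) M \<and>
        M r_ok = of_bool (admissible n h u (m * n) d) \<and> ys' = ys"
      by (simp add: I_def layout_def)
  qed (use env lay in \<open>auto simp: I_def admissible_def\<close>)
  then show ?thesis
    unfolding answer_phase_def
    by (intro run_seq[where ?t1.0 = 1 and ?t2.0 = "m * n * 61 + 6", OF run_block]) auto
qed

lemma run_output_phase:
  assumes n: "n > 0" and env: "env m n M" and cap: "holds Cap (m * n) f M" and ok: "M r_ok = of_bool b"
  shows "run output_phase (m * n * 17 + 10) (M, xs, [])
    (\<lambda>(M, xs, ys). ys = (if b then 1 # map f [0..<m * n] else [0]))"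
  unfolding output_phase_def
proof (rule run_if_le[where t = "m * n * 17 + 8"])
  assume "M r_one \<le> M r_ok"
  then have b using env ok by (cases b) (auto simp: env_def)
  define I where "I q = (\<lambda>(M, xs :: int list, ys). holds Cap (m * n) f M \<and> ys = [1] @ map f [0..<q])" for q
  have "run (scan write_body) (m * n * 17 + 6) (M, xs, [1])
    (\<lambda>(M, xs, ys). ys = (if b then 1 # map f [0..<m * n] else [0]))"
  proof (rule run_scan[OF n, where I = I and m = m and t = 6])
    fix q M xs ys assume q: "q < m * n" and at: "at_entry m n q M" and inv: "I q (M, xs, ys)"
    have hold: "holds Cap (m * n) f M" and ys: "ys = [1] @ map f [0..<q]"
      using inv by (auto simp: I_def)
    show "run write_body 6 (M, xs, ys) (\<lambda>(M, xs, ys). at_entry m n q M \<and> I (Suc q) (M, xs, ys))"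
      unfolding ys by (rule run_weaken[OF run_write_body[OF q at hold] order_refl])
        (simp add: I_def split_beta)
  next
    show "scan_stable (I q)" for q by (auto simp: scan_stable_def I_def)
  qed (use env cap \<open>b\<close> in \<open>auto simp: I_def\<close>)
  then show "run (block [Write r_one] ;; scan write_body) (m * n * 17 + 8) (M, xs, [])
    (\<lambda>(M, xs, ys). ys = (if b then 1 # map f [0..<m * n] else [0]))"
    using env
    by (intro run_seq[where ?t1.0 = 1 and ?t2.0 = "m * n * 17 + 6", OF run_block]) (auto simp: env_def)
next
  assume "\<not> M r_one \<le> M r_ok"
  then have "\<not> b" using env ok by (auto simp: env_def)
  then show "run (block [Write r_zero]) (m * n * 17 + 8) (M, xs, [])
    (\<lambda>(M, xs, ys). ys = (if b then 1 # map f [0..<m * n] else [0]))"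
    using env by (intro run_block) (auto simp: env_def)
qed simp

text \<open>
  The relaxation phase, with \<open>m + n\<close> scans of \<open>m * n\<close> entries each, dominates the running time.
\<close>

lemma run_solver:
  fixes m n :: nat and S :: "int mat" and u :: "nat \<Rightarrow> int"
  defines "h \<equiv> cap_entry S n u"
  defines "d \<equiv> (sweep n h u (m * n) ^^ (m + n)) (\<lambda>_. 0, \<lambda>_. 0)"
  assumes n: "n > 0" and m: "m > 0"
    and inp: "inp = int m # int n #
      map (\<lambda>q. S $$ (q div n - 1, q mod n - 1)) (filter (interior n) [0..<m * n]) @ map u [0..<m * n]"
  shows "run solver (300 * (m * n * (m + n))) (\<lambda>_. 0, inp, []) (\<lambda>(M, xs, ys).
    ys = (if admissible n h u (m * n) d then 1 # map (answer_entry n h u d) [0..<m * n] else [0]))"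
proof -
  define R where "R = (\<lambda>(M :: nat \<Rightarrow> int, xs :: int list, ys).
    ys = (if admissible n h u (m * n) d then 1 # map (answer_entry n h u d) [0..<m * n] else [0]))"
  have 4: "run (answer_phase ;; output_phase) (m * n * 78 + 17) (M, xs, []) R"
    if "env m n M" "layout m n (fst d) (snd d) h u M" for M xs
  proof (rule run_seq[where ?t2.0 = "m * n * 17 + 10"])
    show "run answer_phase (m * n * 61 + 7) (M, xs, []) (\<lambda>s. run output_phase (m * n * 17 + 10) s R)"
      by (rule run_weaken[OF run_answer_phase[OF n that] order_refl])
        (auto simp: R_def dest: run_output_phase[OF n])
  qed simp
  have 3: "run (relax_phase ;; answer_phase ;; output_phase)
      ((m + n) * (m * n * 61 + 9) + 3 + (m * n * 78 + 17)) (M, xs, []) R"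
    if "env m n M" "layout m n (\<lambda>_. 0) (\<lambda>_. 0) h u M" for M xs
    by (rule run_seq[where ?t2.0 = "m * n * 78 + 17", OF run_weaken[OF run_relax_phase[OF n that] order_refl]])
      (auto simp: Let_def simp flip: d_def intro: 4)
  have "run solver (m * n * 82 + 20 + ((m + n) * (m * n * 61 + 9) + 3 + (m * n * 78 + 17)))
      (\<lambda>_. 0, inp, []) R"
    unfolding solver_def
    by (rule run_seq[where ?t2.0 = "(m + n) * (m * n * 61 + 9) + 3 + (m * n * 78 + 17)",
          OF run_weaken[OF run_input_phase[OF n inp] order_refl]])
      (use 3 in \<open>auto simp flip: h_def\<close>)
  moreover have "m * n * 82 + 20 + ((m + n) * (m * n * 61 + 9) + 3 + (m * n * 78 + 17)) \<le>
      300 * (m * n * (m + n))"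
  proof -
    (* Both factors are at least 1, so N * K absorbs the lower order terms. *)
    define N K where "N = m * n" and "K = m + n"
    have pos: "1 \<le> N" "1 \<le> K" using m n by (auto simp: N_def K_def)
    then have "N * 1 \<le> N * K" "1 * K \<le> N * K" by (intro mult_le_mono; simp)+
    moreover have "K * (N * 61 + 9) = 61 * (N * K) + 9 * K" by (simp add: algebra_simps)
    ultimately have "N * 82 + 20 + (K * (N * 61 + 9) + 3 + (N * 78 + 17)) \<le> 300 * (N * K)"
      using pos(1) by linarith
    then show ?thesis by (simp add: N_def K_def)
  qed
  ultimately show ?thesis unfolding R_def using run_weaken by blast
qed

text \<open>
  The next two lemmas translate admissibility of potentials into solvability of the window
  problem, in both directions.
\<close>

lemma answer_correct:
  fixes m n :: nat and S U :: "int mat"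
  defines "u \<equiv> \<lambda>q. U $$ (q div n, q mod n)"
  defines "h \<equiv> cap_entry S n u"
  assumes m: "m \<ge> 2" and n: "n \<ge> 2"
    and S: "S \<in> carrier_mat (m - 1) (n - 1)" and U: "U \<in> carrier_mat m n"
    and adm: "admissible n h u (m * n) d"
  shows "window_solution 2 2 S U (mat m n (\<lambda>(i, j). answer_entry n h u d (i * n + j)))"
    (is "window_solution 2 2 S U ?A")
proof -
  have entry: "?A $$ (i, j) = border_zero S i j + (-1) ^ (i + j) * (fst d i - snd d j)"
      "0 \<le> ?A $$ (i, j)" "?A $$ (i, j) \<le> U $$ (i, j)"
    if "i < m" "j < n" for i j
  proof -
    have "i * n + j < Suc i * n" using that by simp
    also have "\<dots> \<le> m * n" using that by (intro mult_right_mono) auto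
    finally have q: "i * n + j < m * n" .
    have dm: "(i * n + j) div n = i" "(i * n + j) mod n = j" using that by auto
    show "?A $$ (i, j) = border_zero S i j + (-1) ^ (i + j) * (fst d i - snd d j)"
      using that dm by (auto simp: answer_entry_def slack_def h_def cap_entry_def border_entry_def)
    show "0 \<le> ?A $$ (i, j)" "?A $$ (i, j) \<le> U $$ (i, j)"
      using adm[unfolded admissible_def, rule_format, OF q] that dm
      by (auto simp: answer_entry_def slack_def u_def)
  qed
  have "window_sum 2 2 ?A = S"
    using border_zero_plus_potentials[of m n ?A S "fst d" "snd d", OF entry(1)]
    by (subst window_sum_2_2_iff[OF S _ m n]) auto
  then show ?thesis
    using entry(2,3) U by (auto simp: window_solution_def less_eq_mat_def)
qed

lemma solution_admissible:
  fixes m n :: nat and S U A :: "int mat"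
  defines "u \<equiv> \<lambda>q. U $$ (q div n, q mod n)"
  defines "h \<equiv> cap_entry S n u"
  assumes m: "m \<ge> 2" and n: "n \<ge> 2"
    and S: "S \<in> carrier_mat (m - 1) (n - 1)" and U: "U \<in> carrier_mat m n"
    and A: "window_solution 2 2 S U A"
  shows "\<exists>p. admissible n h u (m * n) p"
proof -
  have dim: "dim_row U = m" "dim_col U = n" using U by simp_all
  have nonneg: "0\<^sub>m m n \<le> A" and le: "A \<le> U" and sum: "window_sum 2 2 A = S"
    using A unfolding window_solution_def dim by simp_all
  have carrier: "A \<in> carrier_mat m n"
    using le unfolding less_eq_mat_def dim by (intro carrier_matI) simp_all
  have bounds: "0 \<le> A $$ (i, j) \<and> A $$ (i, j) \<le> U $$ (i, j)" if "i < m" "j < n" for i j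
    using nonneg le carrier that dim by (simp add: less_eq_mat_def)
  have "\<And>i j. Suc i < m \<Longrightarrow> Suc j < n \<Longrightarrow>
      A $$ (i, j) + A $$ (i, Suc j) + A $$ (Suc i, j) + A $$ (Suc i, Suc j) = S $$ (i, j)"
    using iffD1[OF window_sum_2_2_iff[OF S carrier m n] sum] by simp
  from potentials_exist[of m n A S, OF this] obtain x z where
    xz: "\<forall>i<m. \<forall>j<n. A $$ (i, j) = border_zero S i j + (-1) ^ (i + j) * (x i - z j)"
    by auto
  have "admissible n h u (m * n) (x, z)"
    unfolding admissible_def
  proof (intro allI impI)
    fix q assume "q < m * n"
    then have ij: "q div n < m" "q mod n < n" using n by (auto simp: less_mult_imp_div_less)
    show "h q - u q \<le> fst (x, z) (q div n) - snd (x, z) (q mod n) \<and>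
        fst (x, z) (q div n) - snd (x, z) (q mod n) \<le> h q"
      using xz[rule_format, OF ij] bounds[OF ij]
      by (auto simp: h_def cap_entry_def border_entry_def u_def)
  qed
  then show ?thesis ..
qed

theorem theorem2:
  shows "\<exists>(P :: instr list) (c :: nat).
    \<forall>(m :: nat) (n :: nat) (S :: int mat) (U :: int mat).
      m \<ge> 2 \<longrightarrow> n \<ge> 2 \<longrightarrow>
      S \<in> carrier_mat (m - 1) (n - 1) \<longrightarrow> U \<in> carrier_mat m n \<longrightarrow> 0\<^sub>m m n \<le> U \<longrightarrow>
      (\<exists>t ans. ram_computes P (encode_instance m n S U) t (encode_answer ans) \<and>
               t \<le> c * (m * n * (m + n) * (1 + nat (U_min U))) \<and>
               correct_answer 2 2 S U ans)"
proof (rule exI[of _ "solver 0 @ [Halt]"], rule exI[of _ 300], intro allI impI)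
  fix m n :: nat and S U :: "int mat"
  assume m: "m \<ge> 2" and n: "n \<ge> 2"
    and S: "S \<in> carrier_mat (m - 1) (n - 1)" and U: "U \<in> carrier_mat m n"
  define u where "u = (\<lambda>q. U $$ (q div n, q mod n))"
  define h where "h = cap_entry S n u"
  define d where "d = (sweep n h u (m * n) ^^ (m + n)) (\<lambda>_. 0, \<lambda>_. 0)"
  define A where "A = mat m n (\<lambda>(i, j). answer_entry n h u d (i * n + j))"
  define ans where "ans = (if admissible n h u (m * n) d then Some A else None)"
  have "encode_instance m n S U = int m # int n #
      map (\<lambda>q. S $$ (q div n - 1, q mod n - 1)) (filter (interior n) [0..<m * n]) @ map u [0..<m * n]"
    using row_major_interior[OF S] row_major_eq[OF U] m n by (simp add: encode_instance_def u_def)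
  from run_solver[OF _ _ this] have "run solver (300 * (m * n * (m + n)))
      (\<lambda>_. 0, encode_instance m n S U, []) (\<lambda>(M, xs, ys).
        ys = (if admissible n h u (m * n) d then 1 # map (answer_entry n h u d) [0..<m * n] else [0]))"
    using m n unfolding h_def d_def by simp
  moreover have "row_major A = map (answer_entry n h u d) [0..<m * n]"
  proof -
    have "A \<in> carrier_mat m n" by (simp add: A_def)
    from row_major_eq[OF this] show ?thesis
      using n by (auto simp: A_def less_mult_imp_div_less)
  qed
  ultimately have "run solver (300 * (m * n * (m + n)))
      (\<lambda>_. 0, encode_instance m n S U, []) (\<lambda>(M, xs, ys). ys = encode_answer ans)"
    by (cases "admissible n h u (m * n) d") (simp_all add: ans_def)
  then obtain t where t: "t \<le> 300 * (m * n * (m + n))"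
    "ram_computes (solver 0 @ [Halt]) (encode_instance m n S U) t (encode_answer ans)"
    using ram_computes_run by blast
  have "t \<le> 300 * (m * n * (m + n) * (1 + nat (U_min U)))"
    using t(1) by (rule order_trans) simp
  moreover have "correct_answer 2 2 S U ans"
  proof (cases "admissible n h u (m * n) d")
    case True
    then show ?thesis
      using answer_correct[OF m n S U] by (simp add: correct_answer_def ans_def A_def h_def u_def)
  next
    case False
    have "\<not> window_solution 2 2 S U B" for B
    proof
      assume "window_solution 2 2 S U B"
      from solution_admissible[OF m n S U this] obtain p where "admissible n h u (m * n) p"
        by (auto simp: h_def u_def)
      from sweeps_admissible[OF _ this] show False using False n by (simp add: d_def)
    qed
    then show ?thesis using False by (simp add: correct_answer_def ans_def)
  qed
  ultimately show "\<exists>t ans. ram_computes (solver 0 @ [Halt]) (encode_instance m n S U) t (encode_answer ans) \<and>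
      t \<le> 300 * (m * n * (m + n) * (1 + nat (U_min U))) \<and> correct_answer 2 2 S U ans"
    using t(2) by blast
qed

end
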